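(* Let $\psi$ be an entire function and $\varphi(z)=az+b$ with $a,b\in\mathbb{C}$, $|a|\le1$. Then $C_{\psi,\varphi}$ is a bounded cohyponormal operator on $\mathcal{F}^2$ if and only if: $\psi=\psi(0)K_{b\frac{\bar a-1}{a-1}}$ in the case $a\neq1$, and $\psi=\psi(0)K_{-b}$ in the case $a=1$.
   Context: $\mathcal{F}^2$ is the Fock space: the Hilbert space of entire functions $f$ on $\mathbb{C}$ with $\int_{\mathbb{C}}|f(z)|^2\,d\mu(z)<\infty$, where $d\mu(z)=\pi^{-1}e^{-|z|^2}\,dA(z)$, with inner product $\langle f,g\rangle=\int f\overline{g}\,d\mu$. Its reproducing kernel at $w$ is $K_w(z)=e^{\bar w z}$. The weighted composition operator is $C_{\psi,\varphi}f=\psi\cdot(f\circ\varphi)$. A bounded operator $T$ is cohyponormal if $T^*T\le TT^*$. *)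

theory Defs
  imports "HOL-Analysis.Analysis"
begin

definition fock_measure :: "complex measure" where
  "fock_measure = density lborel (\<lambda>z. ennreal (exp (- (cmod z)\<^sup>2) / pi))"

definition fock_space :: "(complex \<Rightarrow> complex) set" where
  "fock_space = {f. f holomorphic_on UNIV \<and> integrable fock_measure (\<lambda>z. (cmod (f z))\<^sup>2)}"

definition fock_inner :: "(complex \<Rightarrow> complex) \<Rightarrow> (complex \<Rightarrow> complex) \<Rightarrow> complex" where
  "fock_inner f g = (LINT z|fock_measure. f z * cnj (g z))"

definition fock_norm :: "(complex \<Rightarrow> complex) \<Rightarrow> real" where
  "fock_norm f = sqrt (LINT z|fock_measure. (cmod (f z))\<^sup>2)"

definition fock_kernel :: "complex \<Rightarrow> complex \<Rightarrow> complex" where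
  "fock_kernel w = (\<lambda>z. exp (cnj w * z))"

definition wcomp :: "(complex \<Rightarrow> complex) \<Rightarrow> (complex \<Rightarrow> complex)
    \<Rightarrow> (complex \<Rightarrow> complex) \<Rightarrow> (complex \<Rightarrow> complex)" where
  "wcomp \<psi> \<phi> f = (\<lambda>z. \<psi> z * f (\<phi> z))"

type_synonym fock_op = "(complex \<Rightarrow> complex) \<Rightarrow> (complex \<Rightarrow> complex)"

definition fock_bounded :: "fock_op \<Rightarrow> bool" where
  "fock_bounded T \<longleftrightarrow> (\<forall>f\<in>fock_space. T f \<in> fock_space) \<and>
     (\<exists>M. \<forall>f\<in>fock_space. fock_norm (T f) \<le> M * fock_norm f)"

text \<open>The Hilbert space adjoint of T (determined on F^2).\<close>
definition fock_adjoint :: "fock_op \<Rightarrow> fock_op" where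
  "fock_adjoint T = (SOME S. (\<forall>g\<in>fock_space. S g \<in> fock_space) \<and>
     (\<forall>f\<in>fock_space. \<forall>g\<in>fock_space. fock_inner (T f) g = fock_inner f (S g)))"

definition fock_op_le :: "fock_op \<Rightarrow> fock_op \<Rightarrow> bool" where
  "fock_op_le A B \<longleftrightarrow> (\<forall>f\<in>fock_space.
     Im (fock_inner (B f) f - fock_inner (A f) f) = 0 \<and>
     Re (fock_inner (B f) f - fock_inner (A f) f) \<ge> 0)"

definition fock_cohyponormal :: "fock_op \<Rightarrow> bool" where
  "fock_cohyponormal T \<longleftrightarrow>
     fock_op_le (fock_adjoint T \<circ> T) (T \<circ> fock_adjoint T)"

end

theory Submission
  imports Defs "HOL-Complex_Analysis.Complex_Analysis" "HOL-Probability.Distributions"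
begin

text \<open>
  Let \<open>a \<noteq> 1\<close> and let \<open>p\<close> be the fixed point of \<open>\<phi>\<close>. Since the adjoint maps \<open>K\<^sub>w\<close> to
  \<open>cnj (\<psi> w) K\<^bsub>\<phi> w\<^esub>\<close>, the kernel \<open>K\<^sub>p\<close> is an eigenvector of \<open>T\<^sup>*\<close>. Cohyponormality gives
  \<open>\<parallel>T K\<^sub>p - \<psi> p K\<^sub>p\<parallel>\<^sup>2 = \<parallel>T K\<^sub>p\<parallel>\<^sup>2 - \<parallel>T\<^sup>* K\<^sub>p\<parallel>\<^sup>2 \<le> 0\<close>, and the equation \<open>T K\<^sub>p = \<psi> p K\<^sub>p\<close>
  determines \<open>\<psi>\<close>. For \<open>a = 1\<close> boundedness alone makes \<open>\<psi> z exp (cnj b z)\<close> a bounded entire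
  function. Conversely, the operators in question are multiples of Weyl translations, or of dilations
  conjugated by Weyl translations, hence normal. All Hilbert space facts, including the existence of
  adjoints, are read off the coefficient identity \<open>\<parallel>f\<parallel>\<^sup>2 = \<Sum> n! \<bar>c n\<bar>\<^sup>2\<close>.
\<close>

section \<open>Rotation invariance and moments of the Gaussian measure\<close>

text \<open>A Borel measure giving every box the product of its side lengths is Lebesgue measure,
  and \<open>Complex\<close> pulls a box back to a rectangle. This opens the way to Fubini in the
  real and imaginary parts.\<close>

lemma lborel_complex_eq_distr:
  "(lborel :: complex measure) = distr (lborel \<Otimes>\<^sub>M lborel) borel (\<lambda>(x, y). Complex x y)"
proof (rule lborel_eqI)
  have [measurable]: "(\<lambda>(x, y). Complex x y) \<in> borel_measurable (lborel \<Otimes>\<^sub>M lborel)"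
    unfolding complex_eq_iff case_prod_beta Complex_eq by measurable
  fix l u :: complex
  assume le: "\<And>b. b \<in> Basis \<Longrightarrow> l \<bullet> b \<le> u \<bullet> b"
  have *: "(\<lambda>(x, y). Complex x y) -` box l u \<inter> space (lborel \<Otimes>\<^sub>M lborel)
      = {Re l<..<Re u} \<times> {Im l<..<Im u}"
    by (auto simp: in_box_complex_iff space_pair_measure)
  have "Re l \<le> Re u" "Im l \<le> Im u"
    using le[of 1] le[of \<i>] by (auto simp: Basis_complex_def inner_complex_def)
  then show "emeasure (distr (lborel \<Otimes>\<^sub>M lborel) borel (\<lambda>(x, y). Complex x y)) (box l u)
      = (\<Prod>b\<in>Basis. (u - l) \<bullet> b)"
    by (subst emeasure_distr)
      (auto simp: * lborel.emeasure_pair_measure_Times Basis_complex_def inner_complex_def ennreal_mult)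
qed simp

text \<open>Both orders of integration are recorded because each of the two shears below translates
  one coordinate and fixes the other, and the translated one has to be innermost.\<close>

lemma nn_integral_lborel_complex:
  fixes f :: "complex \<Rightarrow> ennreal"
  assumes [measurable]: "f \<in> borel_measurable borel"
  shows "(\<integral>\<^sup>+z. f z \<partial>lborel) = (\<integral>\<^sup>+x. \<integral>\<^sup>+y. f (Complex x y) \<partial>lborel \<partial>lborel)"
    and "(\<integral>\<^sup>+z. f z \<partial>lborel) = (\<integral>\<^sup>+y. \<integral>\<^sup>+x. f (Complex x y) \<partial>lborel \<partial>lborel)"
proof -
  have [measurable]: "(\<lambda>(x, y). Complex x y) \<in> borel_measurable (lborel \<Otimes>\<^sub>M lborel)"
    unfolding case_prod_beta Complex_eq by measurable
  have *: "(\<integral>\<^sup>+z. f z \<partial>lborel) = (\<integral>\<^sup>+p. f (case p of (x, y) \<Rightarrow> Complex x y) \<partial>(lborel \<Otimes>\<^sub>M lborel))"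
    by (subst lborel_complex_eq_distr, subst nn_integral_distr) auto
  have m: "(\<lambda>p. f (case p of (x, y) \<Rightarrow> Complex x y)) \<in> borel_measurable (lborel \<Otimes>\<^sub>M lborel)"
    by measurable
  show "(\<integral>\<^sup>+z. f z \<partial>lborel) = (\<integral>\<^sup>+x. \<integral>\<^sup>+y. f (Complex x y) \<partial>lborel \<partial>lborel)"
    unfolding * using lborel.nn_integral_fst[OF m] by simp
  show "(\<integral>\<^sup>+z. f z \<partial>lborel) = (\<integral>\<^sup>+y. \<integral>\<^sup>+x. f (Complex x y) \<partial>lborel \<partial>lborel)"
    unfolding * using lborel_pair.nn_integral_snd[OF m] by simp
qed

lemma nn_integral_lborel_shift:
  fixes f :: "'a::euclidean_space \<Rightarrow> ennreal"
  assumes [measurable]: "f \<in> borel_measurable borel"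
  shows "(\<integral>\<^sup>+x. f (x + t) \<partial>lborel) = (\<integral>\<^sup>+x. f x \<partial>lborel)"
proof -
  have "(\<integral>\<^sup>+x. f x \<partial>lborel) = (\<integral>\<^sup>+x. f x \<partial>distr lborel borel ((+) t))"
    by (simp only: lborel_distr_plus)
  also have "\<dots> = (\<integral>\<^sup>+x. f (t + x) \<partial>lborel)"
    by (subst nn_integral_distr) auto
  finally show ?thesis by (simp add: add.commute)
qed

text \<open>For a fixed value of the other coordinate each shear is a translation, so Fubini reduces
  the claim to translation invariance on the real line.\<close>

lemma nn_integral_lborel_complex_shear:
  fixes f :: "complex \<Rightarrow> ennreal" and t :: real
  assumes [measurable]: "f \<in> borel_measurable borel"
  shows "(\<integral>\<^sup>+z. f (z + of_real (t * Im z)) \<partial>lborel) = (\<integral>\<^sup>+z. f z \<partial>lborel)"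
    and "(\<integral>\<^sup>+z. f (z + \<i> * of_real (t * Re z)) \<partial>lborel) = (\<integral>\<^sup>+z. f z \<partial>lborel)"
proof -
  have [measurable]: "(\<lambda>x. Complex x y) \<in> borel_measurable borel"
    "(\<lambda>y. Complex x y) \<in> borel_measurable borel" for x y :: real
    unfolding Complex_eq by measurable
  have "(\<integral>\<^sup>+z. f (z + of_real (t * Im z)) \<partial>lborel)
      = (\<integral>\<^sup>+y. \<integral>\<^sup>+x. f (Complex (x + t * y) y) \<partial>lborel \<partial>lborel)"
    by (subst nn_integral_lborel_complex(2)) (auto simp: complex_eq_iff intro!: nn_integral_cong arg_cong[where f=f])
  also have "\<dots> = (\<integral>\<^sup>+y. \<integral>\<^sup>+x. f (Complex x y) \<partial>lborel \<partial>lborel)"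
    by (subst nn_integral_lborel_shift[of "\<lambda>x. f (Complex x y)" for y]) auto
  also have "\<dots> = (\<integral>\<^sup>+z. f z \<partial>lborel)"
    by (rule nn_integral_lborel_complex(2)[symmetric]) auto
  finally show "(\<integral>\<^sup>+z. f (z + of_real (t * Im z)) \<partial>lborel) = (\<integral>\<^sup>+z. f z \<partial>lborel)" .
  have "(\<integral>\<^sup>+z. f (z + \<i> * of_real (t * Re z)) \<partial>lborel)
      = (\<integral>\<^sup>+x. \<integral>\<^sup>+y. f (Complex x (y + t * x)) \<partial>lborel \<partial>lborel)"
    by (subst nn_integral_lborel_complex(1)) (auto simp: complex_eq_iff intro!: nn_integral_cong arg_cong[where f=f])
  also have "\<dots> = (\<integral>\<^sup>+x. \<integral>\<^sup>+y. f (Complex x y) \<partial>lborel \<partial>lborel)"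
    by (subst nn_integral_lborel_shift[of "\<lambda>y. f (Complex x y)" for x]) auto
  also have "\<dots> = (\<integral>\<^sup>+z. f z \<partial>lborel)"
    by (rule nn_integral_lborel_complex(1)[symmetric]) auto
  finally show "(\<integral>\<^sup>+z. f (z + \<i> * of_real (t * Re z)) \<partial>lborel) = (\<integral>\<^sup>+z. f z \<partial>lborel)" .
qed

text \<open>A rotation by an angle other than \<open>\<pi>\<close> is a product of three shears.\<close>
lemma nn_integral_lborel_rotation:
  fixes f :: "complex \<Rightarrow> ennreal"
  assumes [measurable]: "f \<in> borel_measurable borel" and "cmod \<omega> = 1" "\<omega> \<noteq> -1"
  shows "(\<integral>\<^sup>+z. f (\<omega> * z) \<partial>lborel) = (\<integral>\<^sup>+z. f z \<partial>lborel)"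
proof -
  define c s where "c = Re \<omega>" and "s = Im \<omega>"
  have cs: "c\<^sup>2 + s\<^sup>2 = 1"
    using assms(2) by (simp add: c_def s_def cmod_def)
  have "1 + c \<noteq> 0"
  proof
    assume "1 + c = 0"
    then have "c = -1" by simp
    with cs have "s = 0" by simp
    with \<open>c = -1\<close> show False using assms(3) by (auto simp: c_def s_def complex_eq_iff)
  qed
  \<comment> \<open>For \<omega> = cis \<theta> this is minus the tangent of \<theta>/2; its
    denominator is where \<omega> = -1 has to be excluded.\<close>
  define t where "t = - s / (1 + c)"
  have ts: "1 + t * s = c" "t * (1 + c) = - s"
    using \<open>1 + c \<noteq> 0\<close> cs by (auto simp: t_def field_simps power2_eq_square)
  have ts2: "t + t * (t * s) + t = - s"
  proof -
    have "t + t * (t * s) + t = t * (1 + (1 + t * s))" by (simp add: algebra_simps)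
    then show ?thesis using ts by simp
  qed
  define A B where "A z = z + of_real (t * Im z)" and "B z = z + \<i> * of_real (s * Re z)" for z
  have ABA: "A (B (A z)) = \<omega> * z" for z
  proof -
    have "Re (A (B (A z))) = Re z * (1 + t * s) + Im z * (t + t * (t * s) + t)"
      by (simp add: A_def B_def algebra_simps)
    moreover have "Im (A (B (A z))) = Im z * (1 + t * s) + s * Re z"
      by (simp add: A_def B_def algebra_simps)
    ultimately show ?thesis
      unfolding ts ts2 by (simp add: complex_eq_iff c_def s_def)
  qed
  have [measurable]: "A \<in> borel_measurable borel" "B \<in> borel_measurable borel"
    unfolding A_def B_def by measurable
  have "(\<integral>\<^sup>+z. f z \<partial>lborel) = (\<integral>\<^sup>+z. f (A z) \<partial>lborel)"
    unfolding A_def by (subst nn_integral_lborel_complex_shear(1)) auto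
  also have "\<dots> = (\<integral>\<^sup>+z. f (A (B z)) \<partial>lborel)"
    unfolding B_def by (subst nn_integral_lborel_complex_shear(2)[of "\<lambda>z. f (A z)"]) auto
  \<comment> \<open>Only the innermost \<open>A\<close> is unfolded, so that the integrand appears
    as \<open>\<lambda>z. f (A (B z))\<close> composed with a shear.\<close>
  also have "\<dots> = (\<integral>\<^sup>+z. f (A (B (A z))) \<partial>lborel)"
    by (subst (3) A_def, subst nn_integral_lborel_complex_shear(1)[of "\<lambda>z. f (A (B z))"]) auto
  finally show ?thesis by (simp add: ABA)
qed

text \<open>The Gaussian density is radial, so rotation invariance is inherited from Lebesgue
  measure.\<close>

lemma distr_fock_measure_rotation:
  assumes "cmod \<omega> = 1" "\<omega> \<noteq> -1"
  shows "distr fock_measure borel ((*) \<omega>) = fock_measure"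
proof (rule measure_eqI)
  fix X :: "complex set"
  assume "X \<in> sets (distr fock_measure borel ((*) \<omega>))"
  then have [measurable]: "X \<in> sets borel" by simp
  have "emeasure (distr fock_measure borel ((*) \<omega>)) X = (\<integral>\<^sup>+z. indicator X (\<omega> * z) \<partial>fock_measure)"
    by (subst nn_integral_distr[symmetric, of "(*) \<omega>" _ borel]) (auto simp: fock_measure_def)
  also have "\<dots> = (\<integral>\<^sup>+z. ennreal (exp (- (cmod (\<omega> * z))\<^sup>2) / pi) * indicator X (\<omega> * z) \<partial>lborel)"
    using assms by (simp add: fock_measure_def nn_integral_density norm_mult)
  also have "\<dots> = (\<integral>\<^sup>+z. ennreal (exp (- (cmod z)\<^sup>2) / pi) * indicator X z \<partial>lborel)"
    using assms by (subst nn_integral_lborel_rotation[of "\<lambda>z. ennreal (exp (- (cmod z)\<^sup>2) / pi) * indicator X z"]) auto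
  also have "\<dots> = emeasure fock_measure X"
    by (simp add: fock_measure_def emeasure_density)
  finally show "emeasure (distr fock_measure borel ((*) \<omega>)) X = emeasure fock_measure X" .
qed (simp add: fock_measure_def)

section \<open>Radial integrals and the even moments\<close>

text \<open>The disc \<open>(cmod z)\<^sup>2 \<le> t\<close> has area pi t for nonnegative t and is
  empty otherwise. Half-lines form an intersection-stable generator, so these areas determine the
  image measure. This does the work of polar coordinates for radial integrands.\<close>

lemma distr_lborel_norm_square:
  "distr (lborel :: complex measure) borel (\<lambda>z. (cmod z)\<^sup>2)
    = density lborel (\<lambda>t. ennreal pi * indicator {0..} t)" (is "?M = ?N")
proof (rule measure_eqI_generator_eq[where E = "range atMost" and \<Omega> = UNIV and A = "\<lambda>n. {..real n}"])
  show "Int_stable (range atMost :: real set set)"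
    by (auto simp: Int_stable_def)
  have "emeasure ?M {..t} = emeasure ?N {..t}" for t
  proof -
    have "emeasure ?M {..t} = emeasure lborel {z::complex. (cmod z)\<^sup>2 \<le> t}"
      by (subst emeasure_distr) (auto intro!: arg_cong[where f="emeasure _"])
    also have "\<dots> = ennreal pi * emeasure lborel {0..t}"
    proof (cases "t \<ge> 0")
      case True
      then have "{z::complex. (cmod z)\<^sup>2 \<le> t} = cball 0 (sqrt t)"
        by (auto simp: real_le_rsqrt) (metis True norm_ge_zero power_mono real_sqrt_pow2)
      then show ?thesis
        using True by (simp add: emeasure_cball unit_ball_vol_2 ennreal_mult)
    next
      case False
      then have "{z::complex. (cmod z)\<^sup>2 \<le> t} = {}"
        by (auto simp: not_le intro: less_le_trans)
      then show ?thesis using False by simp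
    qed
    also have "\<dots> = (\<integral>\<^sup>+x. ennreal pi * indicator {0..t} x \<partial>lborel)"
      by (subst nn_integral_cmult_indicator) auto
    also have "\<dots> = emeasure ?N {..t}"
      by (subst emeasure_density) (auto intro!: nn_integral_cong split: split_indicator)
    finally show ?thesis .
  qed
  then show "\<And>X. X \<in> range atMost \<Longrightarrow> emeasure ?M X = emeasure ?N X" by auto
  have "emeasure ?N {..real i} \<noteq> \<infinity>" for i
  proof -
    have "emeasure ?N {..real i} = (\<integral>\<^sup>+x. ennreal pi * indicator {0..real i} x \<partial>lborel)"
      by (subst emeasure_density) (auto intro!: nn_integral_cong split: split_indicator)
    also have "\<dots> = ennreal pi * emeasure lborel {0..real i}"
      by (subst nn_integral_cmult_indicator) auto
    finally show ?thesis by (simp add: ennreal_mult_eq_top_iff)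
  qed
  then show "emeasure ?M {..real i} \<noteq> \<infinity>" for i
    using \<open>\<And>t. emeasure ?M {..t} = emeasure ?N {..t}\<close> by simp
  show "(\<Union>i. {..real i}) = UNIV"
    by (auto intro: real_arch_simple)
qed (auto simp: borel_eq_atMost)

text \<open>Substituting t for the squared modulus cancels the factor 1/pi and leaves the Gamma
  integral of t^n exp(-t).\<close>

lemma nn_integral_fock_measure_norm_power:
  "(\<integral>\<^sup>+z. ennreal ((cmod z) ^ (2 * n)) \<partial>fock_measure) = fact n"
proof -
  have "(\<integral>\<^sup>+z. ennreal ((cmod z) ^ (2 * n)) \<partial>fock_measure)
      = (\<integral>\<^sup>+z. ennreal (exp (- (cmod z)\<^sup>2) / pi) * ennreal (((cmod z)\<^sup>2) ^ n) \<partial>lborel)"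
    by (simp add: fock_measure_def nn_integral_density power_mult)
  also have "\<dots> = (\<integral>\<^sup>+t. ennreal (exp (- t) / pi) * ennreal (t ^ n) \<partial>distr lborel borel (\<lambda>z. (cmod z)\<^sup>2))"
    by (subst nn_integral_distr) auto
  also have "\<dots> = (\<integral>\<^sup>+t. (ennreal pi * indicator {0..} t) * (ennreal (exp (- t) / pi) * ennreal (t ^ n)) \<partial>lborel)"
    unfolding distr_lborel_norm_square by (subst nn_integral_density) auto
  also have "\<dots> = (\<integral>\<^sup>+t. ennreal (t ^ n * exp (- t)) * indicator {0..} t \<partial>lborel)"
    by (intro nn_integral_cong) (auto simp: ennreal_mult[symmetric] split: split_indicator)
  also have "\<dots> = fact n"
    by (subst nn_intergal_power_times_exp_Ici) (metis ennreal_of_nat_eq_real_of_nat of_nat_fact)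
  finally show ?thesis .
qed

section \<open>The coefficient identity\<close>

lemma sets_fock_measure [simp, measurable_cong]: "sets fock_measure = sets borel"
  by (simp add: fock_measure_def)

lemma space_fock_measure [simp]: "space fock_measure = UNIV"
  by (simp add: fock_measure_def)

lemma ball_in_sets_borel [measurable]: "ball x r \<in> sets borel"
  by simp

interpretation fock: prob_space fock_measure
proof
  have "emeasure fock_measure (space fock_measure) = (\<integral>\<^sup>+z. ennreal ((cmod z) ^ (2 * 0)) \<partial>fock_measure)"
    by simp
  also have "\<dots> = 1"
    by (subst nn_integral_fock_measure_norm_power) simp
  finally show "emeasure fock_measure (space fock_measure) = 1" .
qed

text \<open>A continuous function is bounded on the closed ball and the measure is finite.
  Truncation to balls keeps integrals finite before any growth of the function is
  controlled.\<close>

lemma fock_integrable_on_ball: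
  fixes g :: "complex \<Rightarrow> 'a::{banach, second_countable_topology}"
  assumes "continuous_on UNIV g"
  shows "integrable fock_measure (\<lambda>z. indicator (ball 0 r) z *\<^sub>R g z)"
proof -
  have "compact (g ` cball 0 r)"
    using assms by (intro compact_continuous_image) (auto intro: continuous_on_subset)
  then obtain B where B: "\<And>z. z \<in> cball 0 r \<Longrightarrow> norm (g z) \<le> B"
    using compact_imp_bounded by (fastforce simp: bounded_iff)
  have [measurable]: "g \<in> borel_measurable borel"
    using assms by (rule borel_measurable_continuous_onI)
  show ?thesis
  proof (rule fock.integrable_const_bound[where B = "max B 0"])
    show "(\<lambda>z. indicator (ball 0 r) z *\<^sub>R g z) \<in> borel_measurable fock_measure"
      by measurable
  qed (auto split: split_indicator intro!: AE_I2 le_max_iff_disj[THEN iffD2] B)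
qed

text \<open>A rotation by \<omega> preserves the measure and the ball and multiplies the integrand
  by \<open>\<omega> ^ n * cnj \<omega> ^ m\<close>; once this factor differs from 1, the integral
  must vanish.\<close>

lemma fock_integral_ball_monomials:
  assumes "n \<noteq> m"
  shows "(LINT z|fock_measure. indicator (ball 0 r) z *\<^sub>R (z ^ n * cnj z ^ m)) = 0" (is "?I = 0")
proof -
  define k where "k = real n - real m"
  have "k \<noteq> 0" and "\<bar>k\<bar> \<ge> 1"
    using assms by (auto simp: k_def)
  \<comment> \<open>This angle makes the factor equal to \<i>. As
    \<open>\<bar>k\<bar> \<ge> 1\<close>, it is at most a right angle in size, so \<omega> is not -1
    and rotation invariance applies.\<close>
  define \<omega> where "\<omega> = cis (pi / (2 * k))"
  have \<omega>: "cmod \<omega> = 1" by (simp add: \<omega>_def)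
  have "\<bar>pi / (2 * k)\<bar> \<le> pi / 2"
    using \<open>\<bar>k\<bar> \<ge> 1\<close> by (simp add: abs_divide abs_mult divide_simps)
  then have "Re \<omega> \<ge> 0"
    unfolding \<omega>_def cis.simps abs_le_iff by (intro cos_ge_zero) linarith+
  then have "\<omega> \<noteq> -1" by auto
  have "\<omega> ^ n * cnj \<omega> ^ m = cis (real n * (pi / (2 * k)) - real m * (pi / (2 * k)))"
    by (simp only: \<omega>_def cis_cnj Complex.DeMoivre cis_mult mult_minus_right diff_conv_add_uminus)
  also have "real n * (pi / (2 * k)) - real m * (pi / (2 * k)) = k * (pi / (2 * k))"
    by (simp only: k_def left_diff_distrib)
  also have "\<dots> = pi / 2"
    using \<open>k \<noteq> 0\<close> by simp
  finally have \<omega>i: "\<omega> ^ n * cnj \<omega> ^ m = \<i>" by simp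
  have "?I = (LINT z|distr fock_measure borel ((*) \<omega>). indicator (ball 0 r) z *\<^sub>R (z ^ n * cnj z ^ m))"
    using distr_fock_measure_rotation[OF \<omega> \<open>\<omega> \<noteq> -1\<close>] by simp
  also have "\<dots> = (LINT z|fock_measure. indicator (ball 0 r) (\<omega> * z) *\<^sub>R ((\<omega> * z) ^ n * cnj (\<omega> * z) ^ m))"
  proof (rule integral_distr)
    have "(\<lambda>z::complex. z ^ n * cnj z ^ m) \<in> borel_measurable borel"
      by (intro borel_measurable_continuous_onI continuous_intros)
    then show "(\<lambda>z. indicator (ball 0 r) z *\<^sub>R (z ^ n * cnj z ^ m)) \<in> borel_measurable borel"
      by measurable
  qed measurable
  also have "\<dots> = (LINT z|fock_measure. (\<omega> ^ n * cnj \<omega> ^ m) * (indicator (ball 0 r) z *\<^sub>R (z ^ n * cnj z ^ m)))"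
    using \<omega> by (intro Bochner_Integration.integral_cong)
      (auto simp: norm_mult power_mult_distrib split: split_indicator)
  also have "\<dots> = \<i> * ?I"
    unfolding \<omega>i by (rule integral_mult_right_zero)
  finally have "(1 - \<i>) * ?I = 0" by (simp add: algebra_simps)
  moreover have "1 - \<i> \<noteq> 0" by (auto simp: complex_eq_iff)
  ultimately show ?thesis by simp
qed

text \<open>The squared modulus expands into a double sum, of which orthogonality of the monomials
  on the ball leaves only the diagonal.\<close>

lemma fock_integral_ball_polynomial:
  "(LINT z|fock_measure. indicator (ball 0 r) z *\<^sub>R (cmod (\<Sum>n<N. c n * z ^ n))\<^sup>2)
    = (\<Sum>n<N. (cmod (c n))\<^sup>2 * (LINT z|fock_measure. indicator (ball 0 r) z *\<^sub>R (cmod z) ^ (2 * n)))"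
    (is "?L = ?R")
proof -
  let ?J = "\<lambda>n m. LINT z|fock_measure. indicator (ball 0 r) z *\<^sub>R (z ^ n * cnj z ^ m)"
  have int: "integrable fock_measure (\<lambda>z. indicator (ball 0 r) z *\<^sub>R (z ^ n * cnj z ^ m))" for n m
    by (intro fock_integrable_on_ball continuous_intros)
  have diag: "?J n n = of_real (LINT z|fock_measure. indicator (ball 0 r) z *\<^sub>R (cmod z) ^ (2 * n))" for n
  proof -
    have "z ^ n * cnj z ^ n = of_real (cmod z ^ (2 * n))" for z
      by (metis complex_norm_square of_real_power power_mult power_mult_distrib)
    then show ?thesis
      unfolding integral_complex_of_real[symmetric]
      by (intro Bochner_Integration.integral_cong) (auto split: split_indicator)
  qed
  have "complex_of_real ?L = (LINT z|fock_measure. complex_of_real (indicator (ball 0 r) z *\<^sub>R (cmod (\<Sum>n<N. c n * z ^ n))\<^sup>2))"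
    by (rule integral_complex_of_real[symmetric])
  also have "\<dots> = (LINT z|fock_measure. (\<Sum>n<N. \<Sum>m<N. (c n * cnj (c m)) * (indicator (ball 0 r) z *\<^sub>R (z ^ n * cnj z ^ m))))"
  proof (intro Bochner_Integration.integral_cong refl)
    fix z
    have "complex_of_real ((cmod (\<Sum>n<N. c n * z ^ n))\<^sup>2) = (\<Sum>n<N. c n * z ^ n) * cnj (\<Sum>n<N. c n * z ^ n)"
      by (simp add: complex_norm_square del: of_real_power)
    also have "\<dots> = (\<Sum>n<N. \<Sum>m<N. (c n * cnj (c m)) * (z ^ n * cnj z ^ m))"
      by (simp add: sum_product mult_ac)
    finally have *: "complex_of_real ((cmod (\<Sum>n<N. c n * z ^ n))\<^sup>2) = (\<Sum>n<N. \<Sum>m<N. (c n * cnj (c m)) * (z ^ n * cnj z ^ m))" .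
    show "complex_of_real (indicator (ball 0 r) z *\<^sub>R (cmod (\<Sum>n<N. c n * z ^ n))\<^sup>2)
      = (\<Sum>n<N. \<Sum>m<N. (c n * cnj (c m)) * (indicator (ball 0 r) z *\<^sub>R (z ^ n * cnj z ^ m)))"
      unfolding real_scaleR_def of_real_mult * scaleR_conv_of_real sum_distrib_left
      by (intro sum.cong refl) (simp only: mult_ac)
  qed
  also have "\<dots> = (\<Sum>n<N. \<Sum>m<N. (c n * cnj (c m)) * ?J n m)"
    by (simp only: Bochner_Integration.integral_sum Bochner_Integration.integrable_sum
        integrable_mult_right int integral_mult_right_zero)
  also have "\<dots> = (\<Sum>n<N. \<Sum>m<N. if m = n then (c n * cnj (c n)) * ?J n n else 0)"
    by (intro sum.cong refl) (auto simp: fock_integral_ball_monomials)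
  also have "\<dots> = (\<Sum>n<N. (c n * cnj (c n)) * ?J n n)"
    by (intro sum.cong refl, subst sum.delta) auto
  also have "\<dots> = complex_of_real ?R"
    unfolding diag complex_norm_square[symmetric] by simp
  finally show ?thesis
    unfolding of_real_eq_iff .
qed

section \<open>From polynomials on discs to entire functions on the plane\<close>

lemma holomorphic_on_power_series_sums:
  assumes "\<And>z. (\<lambda>n. c n * z ^ n) sums f z"
  shows "f holomorphic_on UNIV"
proof -
  have "f holomorphic_on ball 0 r" for r
    using assms by (intro power_series_holomorphic[of 0 r c]) simp
  then show ?thesis
    unfolding holomorphic_on_def
    by (metis UNIV_I at_within_open centre_in_ball gt_ex linorder_not_le mem_ball_0 open_UNIV open_ball)
qed

text \<open>By the polynomial case the partial sums of the series are integrals of squared partial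
  sums of \<open>f\<close>. On the ball these are bounded uniformly by absolute convergence, so
  dominated convergence applies.\<close>

lemma fock_sums_ball:
  assumes sums: "\<And>z. (\<lambda>n. c n * z ^ n) sums f z"
  shows "(\<lambda>n. (cmod (c n))\<^sup>2 * (LINT z|fock_measure. indicator (ball 0 r) z *\<^sub>R (cmod z) ^ (2 * n)))
    sums (LINT z|fock_measure. indicator (ball 0 r) z *\<^sub>R (cmod (f z))\<^sup>2)"
  unfolding sums_def fock_integral_ball_polynomial[symmetric]
proof (rule integral_dominated_convergence)
  have cf: "continuous_on UNIV f"
    using holomorphic_on_power_series_sums[OF sums] by (rule holomorphic_on_imp_continuous_on)
  have [measurable]: "f \<in> borel_measurable borel"
    using cf by (rule borel_measurable_continuous_onI)
  show "(\<lambda>z. indicator (ball 0 r) z *\<^sub>R (cmod (f z))\<^sup>2) \<in> borel_measurable fock_measure"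
    "\<And>N. (\<lambda>z. indicator (ball 0 r) z *\<^sub>R (cmod (\<Sum>n<N. c n * z ^ n))\<^sup>2) \<in> borel_measurable fock_measure"
    by measurable
  define B where "B = (\<Sum>n. cmod (c n * of_real r ^ n))"
  \<comment> \<open>Absolute convergence at modulus \<open>\<bar>r\<bar>\<close> comes from
    convergence at the strictly larger modulus \<open>\<bar>r\<bar> + 1\<close>.\<close>
  have summ: "summable (\<lambda>n. cmod (c n * of_real r ^ n))"
    using powser_insidea[of c "of_real (\<bar>r\<bar> + 1)" "of_real r"] sums_summable[OF sums]
    by (simp flip: of_real_add)
  show "integrable fock_measure (\<lambda>z. B\<^sup>2)" by simp
  show "AE z in fock_measure. (\<lambda>N. indicator (ball 0 r) z *\<^sub>R (cmod (\<Sum>n<N. c n * z ^ n))\<^sup>2)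
     \<longlonglongrightarrow> indicator (ball 0 r) z *\<^sub>R (cmod (f z))\<^sup>2"
    using sums by (intro AE_I2 tendsto_intros) (simp add: sums_def)
  show "AE z in fock_measure. norm (indicator (ball 0 r) z *\<^sub>R (cmod (\<Sum>n<N. c n * z ^ n))\<^sup>2) \<le> B\<^sup>2" for N
  proof (intro AE_I2)
    fix z
    have "cmod (\<Sum>n<N. c n * z ^ n) \<le> B" if "cmod z < r"
    proof -
      have "cmod (\<Sum>n<N. c n * z ^ n) \<le> (\<Sum>n<N. cmod (c n * of_real r ^ n))"
        using that by (intro sum_norm_le) (auto simp: norm_mult norm_power intro!: mult_left_mono power_mono)
      also have "\<dots> \<le> B"
        unfolding B_def by (intro sum_le_suminf summ) auto
      finally show ?thesis .
    qed
    then show "norm (indicator (ball 0 r) z *\<^sub>R (cmod (\<Sum>n<N. c n * z ^ n))\<^sup>2) \<le> B\<^sup>2"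
      by (auto split: split_indicator intro!: power_mono)
  qed
qed

lemma nn_integral_fock_SUP_ball:
  assumes [measurable]: "g \<in> borel_measurable borel"
  shows "(\<integral>\<^sup>+z. g z \<partial>fock_measure) = (SUP k. \<integral>\<^sup>+z. indicator (ball 0 (real k)) z * g z \<partial>fock_measure)"
    and "incseq (\<lambda>k. \<integral>\<^sup>+z. indicator (ball 0 (real k)) z * g z \<partial>fock_measure)"
proof -
  have inc: "incseq (\<lambda>k z. indicator (ball 0 (real k)) z * g z)"
    by (auto simp: incseq_def le_fun_def split: split_indicator)
  have "(SUP k. indicator (ball 0 (real k)) z * g z) = g z" for z
  proof (rule antisym)
    obtain k where "cmod z < real k" using reals_Archimedean2 by blast
    then show "g z \<le> (SUP k. indicator (ball 0 (real k)) z * g z)"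
      by (intro SUP_upper2[of k]) auto
  qed (auto intro!: SUP_least split: split_indicator)
  then have "(\<integral>\<^sup>+z. g z \<partial>fock_measure) = (\<integral>\<^sup>+z. (SUP k. indicator (ball 0 (real k)) z * g z) \<partial>fock_measure)"
    by simp
  also have "\<dots> = (SUP k. \<integral>\<^sup>+z. indicator (ball 0 (real k)) z * g z \<partial>fock_measure)"
    using inc by (intro nn_integral_monotone_convergence_SUP) measurable
  finally show "(\<integral>\<^sup>+z. g z \<partial>fock_measure) = (SUP k. \<integral>\<^sup>+z. indicator (ball 0 (real k)) z * g z \<partial>fock_measure)" .
  show "incseq (\<lambda>k. \<integral>\<^sup>+z. indicator (ball 0 (real k)) z * g z \<partial>fock_measure)"
    using inc by (auto simp: incseq_def le_fun_def intro!: nn_integral_mono)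
qed

text \<open>The identity on balls passes to the limit by monotone convergence on both sides. In
  extended nonnegative reals both sides may be infinite, so that finiteness of one can be read off
  the other.\<close>

lemma nn_integral_fock_parseval:
  assumes sums: "\<And>z. (\<lambda>n. c n * z ^ n) sums f z"
  shows "(\<integral>\<^sup>+z. ennreal ((cmod (f z))\<^sup>2) \<partial>fock_measure) = (\<Sum>n. ennreal (fact n * (cmod (c n))\<^sup>2))"
proof -
  have cf: "continuous_on UNIV f"
    using holomorphic_on_power_series_sums[OF sums] by (rule holomorphic_on_imp_continuous_on)
  have [measurable]: "f \<in> borel_measurable borel"
    using cf by (rule borel_measurable_continuous_onI)
  have *: "(\<integral>\<^sup>+z. indicator (ball 0 r) z * ennreal (g z) \<partial>fock_measure)
      = ennreal (LINT z|fock_measure. indicator (ball 0 r) z *\<^sub>R g z)"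
    if "continuous_on UNIV g" "\<And>z. g z \<ge> 0" for g :: "complex \<Rightarrow> real" and r
    using that fock_integrable_on_ball[OF that(1)] by (subst nn_integral_eq_integral[symmetric])
      (auto intro!: nn_integral_cong split: split_indicator)
  have ball: "(\<integral>\<^sup>+z. indicator (ball 0 r) z * ennreal ((cmod (f z))\<^sup>2) \<partial>fock_measure)
      = (\<Sum>n. ennreal ((cmod (c n))\<^sup>2) * (\<integral>\<^sup>+z. indicator (ball 0 r) z * ennreal ((cmod z) ^ (2 * n)) \<partial>fock_measure))" for r
  proof -
    have "(\<integral>\<^sup>+z. indicator (ball 0 r) z * ennreal ((cmod (f z))\<^sup>2) \<partial>fock_measure)
        = ennreal (LINT z|fock_measure. indicator (ball 0 r) z *\<^sub>R (cmod (f z))\<^sup>2)"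
      by (intro * continuous_intros cf) auto
    also have "\<dots> = (\<Sum>n. ennreal ((cmod (c n))\<^sup>2 * (LINT z|fock_measure. indicator (ball 0 r) z *\<^sub>R (cmod z) ^ (2 * n))))"
      by (rule sums_unique, rule sums_ennreal[THEN iffD2])
        (use fock_sums_ball[OF sums] in \<open>auto intro!: mult_nonneg_nonneg Bochner_Integration.integral_nonneg\<close>)
    also have "\<dots> = (\<Sum>n. ennreal ((cmod (c n))\<^sup>2) * (\<integral>\<^sup>+z. indicator (ball 0 r) z * ennreal ((cmod z) ^ (2 * n)) \<partial>fock_measure))"
      by (subst *) (auto simp: ennreal_mult' intro!: continuous_intros)
    finally show ?thesis .
  qed
  have "(\<integral>\<^sup>+z. ennreal ((cmod (f z))\<^sup>2) \<partial>fock_measure)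
      = (SUP k. \<Sum>n. ennreal ((cmod (c n))\<^sup>2) * (\<integral>\<^sup>+z. indicator (ball 0 (real k)) z * ennreal ((cmod z) ^ (2 * n)) \<partial>fock_measure))"
    unfolding ball[symmetric] by (rule nn_integral_fock_SUP_ball) simp
  also have "\<dots> = (\<Sum>n. SUP k. ennreal ((cmod (c n))\<^sup>2) * (\<integral>\<^sup>+z. indicator (ball 0 (real k)) z * ennreal ((cmod z) ^ (2 * n)) \<partial>fock_measure))"
  proof (rule ennreal_suminf_SUP_eq[symmetric])
    show "incseq (\<lambda>k. ennreal ((cmod (c n))\<^sup>2) * (\<integral>\<^sup>+z. indicator (ball 0 (real k)) z * ennreal ((cmod z) ^ (2 * n)) \<partial>fock_measure))" for n
      using nn_integral_fock_SUP_ball(2)[of "\<lambda>z. ennreal ((cmod z) ^ (2 * n))"]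
      by (auto simp: incseq_def intro!: mult_left_mono)
  qed
  also have "\<dots> = (\<Sum>n. ennreal ((cmod (c n))\<^sup>2) * fact n)"
    by (simp add: SUP_mult_left_ennreal[symmetric] nn_integral_fock_SUP_ball(1)[symmetric] nn_integral_fock_measure_norm_power)
  also have "\<dots> = (\<Sum>n. ennreal (fact n * (cmod (c n))\<^sup>2))"
    by (intro suminf_cong) (metis ennreal_mult' ennreal_of_nat_eq_real_of_nat fact_ge_zero mult.commute of_nat_fact)
  finally show ?thesis .
qed

section \<open>Inner product and reproducing kernel\<close>

lemma fock_space_iff_summable:
  assumes sums: "\<And>z. (\<lambda>n. c n * z ^ n) sums f z"
  shows "f \<in> fock_space \<longleftrightarrow> summable (\<lambda>n. fact n * (cmod (c n))\<^sup>2)"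
    and "f \<in> fock_space \<Longrightarrow> (\<lambda>n. fact n * (cmod (c n))\<^sup>2) sums (LINT z|fock_measure. (cmod (f z))\<^sup>2)"
proof -
  have hol: "f holomorphic_on UNIV"
    by (rule holomorphic_on_power_series_sums[OF sums])
  have [measurable]: "f \<in> borel_measurable borel"
    using holomorphic_on_imp_continuous_on[OF hol] by (rule borel_measurable_continuous_onI)
  have "integrable fock_measure (\<lambda>z. (cmod (f z))\<^sup>2)
      \<longleftrightarrow> (\<integral>\<^sup>+z. ennreal ((cmod (f z))\<^sup>2) \<partial>fock_measure) < \<infinity>"
    by (auto simp: integrable_iff_bounded)
  also have "\<dots> \<longleftrightarrow> summable (\<lambda>n. fact n * (cmod (c n))\<^sup>2)"
  proof
    show "summable (\<lambda>n. fact n * (cmod (c n))\<^sup>2)"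
      if "(\<integral>\<^sup>+z. ennreal ((cmod (f z))\<^sup>2) \<partial>fock_measure) < \<infinity>"
      using that unfolding nn_integral_fock_parseval[OF sums]
      by (intro summable_suminf_not_top) (auto simp: less_top)
    show "(\<integral>\<^sup>+z. ennreal ((cmod (f z))\<^sup>2) \<partial>fock_measure) < \<infinity>"
      if "summable (\<lambda>n. fact n * (cmod (c n))\<^sup>2)"
      unfolding nn_integral_fock_parseval[OF sums] using that
      by (subst suminf_ennreal2) auto
  qed
  finally have int: "integrable fock_measure (\<lambda>z. (cmod (f z))\<^sup>2)
      \<longleftrightarrow> summable (\<lambda>n. fact n * (cmod (c n))\<^sup>2)" .
  then show iff: "f \<in> fock_space \<longleftrightarrow> summable (\<lambda>n. fact n * (cmod (c n))\<^sup>2)"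
    using hol by (auto simp: fock_space_def)
  assume "f \<in> fock_space"
  then have "integrable fock_measure (\<lambda>z. (cmod (f z))\<^sup>2)"
    by (simp add: fock_space_def)
  then have "(\<lambda>n. ennreal (fact n * (cmod (c n))\<^sup>2)) sums ennreal (LINT z|fock_measure. (cmod (f z))\<^sup>2)"
    by (subst nn_integral_eq_integral[symmetric])
      (auto simp: nn_integral_fock_parseval[OF sums] summable_sums)
  then show "(\<lambda>n. fact n * (cmod (c n))\<^sup>2) sums (LINT z|fock_measure. (cmod (f z))\<^sup>2)"
    by (subst (asm) sums_ennreal) auto
qed

definition fock_coeff :: "(complex \<Rightarrow> complex) \<Rightarrow> nat \<Rightarrow> complex" where
  "fock_coeff f n = (deriv ^^ n) f 0 / fact n"

lemma fock_coeff_sums: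
  assumes "f holomorphic_on UNIV"
  shows "(\<lambda>n. fock_coeff f n * z ^ n) sums f z"
  using holomorphic_power_series[of f 0 "cmod z + 1" z] holomorphic_on_subset[OF assms]
  by (simp add: fock_coeff_def)

lemma fock_space_holomorphic: "f \<in> fock_space \<Longrightarrow> f holomorphic_on UNIV"
  by (simp add: fock_space_def)

lemma fock_space_borel_measurable: "f \<in> fock_space \<Longrightarrow> f \<in> borel_measurable borel"
  by (intro borel_measurable_continuous_onI holomorphic_on_imp_continuous_on fock_space_holomorphic)

lemma fock_space_add:
  assumes "f \<in> fock_space" "g \<in> fock_space"
  shows "(\<lambda>z. f z + g z) \<in> fock_space"
proof -
  note [measurable] = assms[THEN fock_space_borel_measurable]
  have "integrable fock_measure (\<lambda>z. 2 * ((cmod (f z))\<^sup>2 + (cmod (g z))\<^sup>2))"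
    using assms by (auto simp: fock_space_def)
  then have "integrable fock_measure (\<lambda>z. (cmod (f z + g z))\<^sup>2)"
  proof (rule Bochner_Integration.integrable_bound)
    show "AE z in fock_measure. norm ((cmod (f z + g z))\<^sup>2) \<le> norm (2 * ((cmod (f z))\<^sup>2 + (cmod (g z))\<^sup>2))"
    proof (intro AE_I2)
      fix z
      have "(cmod (f z + g z))\<^sup>2 \<le> (cmod (f z) + cmod (g z))\<^sup>2"
        by (intro power_mono norm_triangle_ineq) simp
      also have "\<dots> \<le> 2 * ((cmod (f z))\<^sup>2 + (cmod (g z))\<^sup>2)"
        using sum_squares_bound[of "cmod (f z)" "cmod (g z)"] by (simp add: power2_sum)
      finally show "norm ((cmod (f z + g z))\<^sup>2) \<le> norm (2 * ((cmod (f z))\<^sup>2 + (cmod (g z))\<^sup>2))"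
        by simp
    qed
  qed measurable
  with assms show ?thesis by (auto simp: fock_space_def intro!: holomorphic_intros)
qed

lemma fock_space_cmult: "f \<in> fock_space \<Longrightarrow> (\<lambda>z. c * f z) \<in> fock_space"
  by (auto simp: fock_space_def norm_mult power_mult_distrib intro!: holomorphic_intros)

lemma fock_space_diff:
  assumes "f \<in> fock_space" "g \<in> fock_space"
  shows "(\<lambda>z. f z - g z) \<in> fock_space"
  using fock_space_add[OF assms(1) fock_space_cmult[OF assms(2), of "-1"]] by simp

text \<open>The product is dominated by the sum of the squared moduli. Linearity of
  \<open>fock_inner\<close> rests on this, since the Bochner integral of a non-integrable function
  is 0 by default.\<close>

lemma fock_integrable_mult:
  assumes "f \<in> fock_space" "g \<in> fock_space"
  shows "integrable fock_measure (\<lambda>z. f z * cnj (g z))"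
proof -
  note [measurable] = assms[THEN fock_space_borel_measurable]
  have "integrable fock_measure (\<lambda>z. (cmod (f z))\<^sup>2 + (cmod (g z))\<^sup>2)"
    using assms by (auto simp: fock_space_def)
  then show ?thesis
  proof (rule Bochner_Integration.integrable_bound)
    have "(\<lambda>z. cnj (g z)) \<in> borel_measurable fock_measure"
      by (rule measurable_compose[where N = borel])
        (auto intro!: borel_measurable_continuous_onI continuous_intros)
    then show "(\<lambda>z. f z * cnj (g z)) \<in> borel_measurable fock_measure"
      by measurable
    show "AE z in fock_measure. norm (f z * cnj (g z)) \<le> norm ((cmod (f z))\<^sup>2 + (cmod (g z))\<^sup>2)"
    proof (intro AE_I2)
      fix z
      show "norm (f z * cnj (g z)) \<le> norm ((cmod (f z))\<^sup>2 + (cmod (g z))\<^sup>2)"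
        using sum_squares_bound[of "cmod (f z)" "cmod (g z)"] mult_nonneg_nonneg[of "cmod (f z)" "cmod (g z)"]
        unfolding norm_mult complex_mod_cnj real_norm_def by linarith
    qed
  qed
qed

lemma fock_inner_add_left:
  "f \<in> fock_space \<Longrightarrow> g \<in> fock_space \<Longrightarrow> h \<in> fock_space \<Longrightarrow>
    fock_inner (\<lambda>z. f z + g z) h = fock_inner f h + fock_inner g h"
  by (simp add: fock_inner_def distrib_right fock_integrable_mult)

lemma fock_inner_diff_left:
  "f \<in> fock_space \<Longrightarrow> g \<in> fock_space \<Longrightarrow> h \<in> fock_space \<Longrightarrow>
    fock_inner (\<lambda>z. f z - g z) h = fock_inner f h - fock_inner g h"
  by (simp add: fock_inner_def left_diff_distrib fock_integrable_mult)

lemma fock_inner_cmult_left: "fock_inner (\<lambda>z. c * f z) h = c * fock_inner f h"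
  by (simp add: fock_inner_def mult.assoc)

lemma fock_inner_commute: "fock_inner g f = cnj (fock_inner f g)"
  unfolding fock_inner_def by (subst Bochner_Integration.integral_cnj[symmetric]) (simp add: mult.commute)

lemma fock_inner_diff_right:
  "f \<in> fock_space \<Longrightarrow> g \<in> fock_space \<Longrightarrow> h \<in> fock_space \<Longrightarrow>
    fock_inner h (\<lambda>z. f z - g z) = fock_inner h f - fock_inner h g"
  by (simp add: fock_inner_commute[of h] fock_inner_diff_left)

lemma fock_inner_cmult_right: "fock_inner f (\<lambda>z. c * h z) = cnj c * fock_inner f h"
  by (simp add: fock_inner_commute[of f] fock_inner_cmult_left)

lemma fock_norm_nonneg [simp]: "fock_norm f \<ge> 0"
  by (simp add: fock_norm_def)

lemma fock_norm_sq: "(fock_norm f)\<^sup>2 = (LINT z|fock_measure. (cmod (f z))\<^sup>2)"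
  by (simp add: fock_norm_def)

lemma fock_inner_self: "fock_inner f f = of_real ((fock_norm f)\<^sup>2)"
  unfolding fock_norm_sq fock_inner_def integral_complex_of_real[symmetric]
  by (simp only: complex_norm_square)

lemma fock_norm_sums:
  assumes "\<And>z. (\<lambda>n. c n * z ^ n) sums f z" "f \<in> fock_space"
  shows "(\<lambda>n. fact n * (cmod (c n))\<^sup>2) sums (fock_norm f)\<^sup>2"
  unfolding fock_norm_sq using assms by (rule fock_space_iff_summable(2))

text \<open>A vanishing sum of nonnegative terms kills every Taylor coefficient, which gives
  equality at every point rather than almost everywhere.\<close>

lemma fock_norm_eq_0:
  assumes "f \<in> fock_space" "fock_norm f = 0"
  shows "f = (\<lambda>z. 0)"
proof
  fix z
  have c: "\<And>z. (\<lambda>n. fock_coeff f n * z ^ n) sums f z"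
    using assms fock_coeff_sums fock_space_holomorphic by blast
  have "(\<lambda>n. fact n * (cmod (fock_coeff f n))\<^sup>2) sums 0"
    using fock_norm_sums[OF c assms(1)] assms(2) by simp
  then have "\<forall>n. fact n * (cmod (fock_coeff f n))\<^sup>2 = 0"
    using suminf_eq_zero_iff[of "\<lambda>n. fact n * (cmod (fock_coeff f n))\<^sup>2"] by (auto simp: sums_iff)
  then have "fock_coeff f n = 0" for n by simp
  then show "f z = 0"
    using c[of z] by (simp add: sums_iff)
qed

text \<open>Polarization turns the norm identity into one for inner products.\<close>
lemma fock_inner_sums:
  assumes c: "\<And>z. (\<lambda>n. c n * z ^ n) sums f z" and d: "\<And>z. (\<lambda>n. d n * z ^ n) sums g z"
    and f: "f \<in> fock_space" and g: "g \<in> fock_space"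
  shows "(\<lambda>n. fact n * (c n * cnj (d n))) sums fock_inner f g"
proof -
  define q where "q x y u = complex_of_real ((cmod (x + u * y))\<^sup>2)" for x y u
  \<comment> \<open>Polarization is used twice: on the function values under the integral, and on
    the coefficients in the series.\<close>
  have pol: "4 * (x * cnj y) = q x y 1 - q x y (-1) + \<i> * q x y \<i> - \<i> * q x y (-\<i>)" for x y
    unfolding q_def
    by (simp add: complex_eq_iff cmod_power2 del: of_real_power) (simp add: power2_eq_square algebra_simps)
  define I where "I u = (LINT z|fock_measure. q (f z) (g z) u)" for u
  have s: "(\<lambda>n. fact n * q (c n) (d n) u) sums I u" for u
  proof -
    have "(\<lambda>n. fact n * (cmod (c n + u * d n))\<^sup>2) sums (LINT z|fock_measure. (cmod (f z + u * g z))\<^sup>2)"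
    proof (rule fock_space_iff_summable(2))
      show "(\<lambda>z. f z + u * g z) \<in> fock_space"
        by (intro fock_space_add fock_space_cmult f g)
      show "(\<lambda>n. (c n + u * d n) * z ^ n) sums (f z + u * g z)" for z
        using sums_add[OF c[of z] sums_mult[OF d[of z], of u]] by (simp add: algebra_simps)
    qed
    then have "(\<lambda>n. complex_of_real (fact n * (cmod (c n + u * d n))\<^sup>2)) sums
        complex_of_real (LINT z|fock_measure. (cmod (f z + u * g z))\<^sup>2)"
      by (rule sums_of_real)
    then show ?thesis
      unfolding I_def q_def integral_complex_of_real of_real_mult of_real_fact .
  qed
  have i: "integrable fock_measure (\<lambda>z. q (f z) (g z) u)" for u
    using fock_space_add[OF f fock_space_cmult[OF g, of u]] unfolding q_def
    by (intro integrable_of_real) (simp add: fock_space_def)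
  have "4 * fock_inner f g = (LINT z|fock_measure. 4 * (f z * cnj (g z)))"
    unfolding fock_inner_def by (rule integral_mult_right_zero[symmetric])
  also have "\<dots> = I 1 - I (-1) + \<i> * I \<i> - \<i> * I (-\<i>)"
    unfolding pol I_def by (simp add: i)
  finally have I: "4 * fock_inner f g = I 1 - I (-1) + \<i> * I \<i> - \<i> * I (-\<i>)" .
  have "4 * (fact n * (c n * cnj (d n))) = fact n * q (c n) (d n) 1 - fact n * q (c n) (d n) (-1)
      + \<i> * (fact n * q (c n) (d n) \<i>) - \<i> * (fact n * q (c n) (d n) (-\<i>))" for n
  proof -
    have "4 * (fact n * (c n * cnj (d n))) = fact n * (4 * (c n * cnj (d n)))"
      by simp
    then show ?thesis unfolding pol by (simp add: algebra_simps)
  qed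
  then have "(\<lambda>n. 4 * (fact n * (c n * cnj (d n)))) sums (4 * fock_inner f g)"
    unfolding I
    using sums_diff[OF sums_add[OF sums_diff[OF s[of 1] s[of "-1"]] sums_mult[OF s[of \<i>], of \<i>]]
      sums_mult[OF s[of "-\<i>"], of \<i>]]
    by (simp only:)
  from sums_mult[OF this, of "1/4"] show ?thesis by simp
qed

text \<open>The term is split as sqrt(n!) |c n| times |z|^n / sqrt(n!), and a product is at most the
  sum of the squares. The lemma turns weighted square-summable coefficients into an entire
  function.\<close>

lemma fock_power_series:
  assumes "summable (\<lambda>n. fact n * (cmod (c n))\<^sup>2)"
  shows "summable (\<lambda>n. c n * z ^ n)"
proof (rule summable_comparison_test)
  have "summable (\<lambda>n. ((cmod z)\<^sup>2) ^ n /\<^sub>R fact n)"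
    by (rule summable_exp_generic)
  then show "summable (\<lambda>n. fact n * (cmod (c n))\<^sup>2 + ((cmod z)\<^sup>2) ^ n /\<^sub>R fact n)"
    using assms by (intro summable_add)
  have "norm (c n * z ^ n) \<le> fact n * (cmod (c n))\<^sup>2 + ((cmod z)\<^sup>2) ^ n /\<^sub>R fact n" for n
  proof -
    define x y where "x = sqrt (fact n) * cmod (c n)" and "y = cmod z ^ n / sqrt (fact n)"
    have "x * y \<ge> 0" by (simp add: x_def y_def)
    moreover have "2 * x * y \<le> x\<^sup>2 + y\<^sup>2" by (rule sum_squares_bound)
    moreover have "norm (c n * z ^ n) = x * y"
      by (simp add: x_def y_def norm_mult norm_power)
    moreover have "x\<^sup>2 = fact n * (cmod (c n))\<^sup>2"
      by (simp add: x_def power_mult_distrib)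
    moreover have "y\<^sup>2 = ((cmod z)\<^sup>2) ^ n /\<^sub>R fact n"
      unfolding y_def power_divide by (simp add: mult.commute divide_inverse_commute flip: power_mult)
    ultimately show ?thesis by linarith
  qed
  then show "\<exists>N. \<forall>n\<ge>N. norm (c n * z ^ n) \<le> fact n * (cmod (c n))\<^sup>2 + ((cmod z)\<^sup>2) ^ n /\<^sub>R fact n"
    by blast
qed

section \<open>The reproducing kernel and the Cauchy-Schwarz inequality\<close>

lemma fock_kernel_sums: "(\<lambda>n. (cnj w ^ n / fact n) * z ^ n) sums fock_kernel w z"
  using exp_converges[of "cnj w * z"]
  by (simp add: fock_kernel_def power_mult_distrib scaleR_conv_of_real divide_inverse mult_ac)

lemma fock_kernel_in_fock_space [simp]: "fock_kernel w \<in> fock_space"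
proof -
  have "(\<lambda>n. ((cmod w)\<^sup>2) ^ n /\<^sub>R fact n) = (\<lambda>n. fact n * (cmod (cnj w ^ n / fact n))\<^sup>2)"
  proof
    show "((cmod w)\<^sup>2) ^ n /\<^sub>R fact n = fact n * (cmod (cnj w ^ n / fact n))\<^sup>2" for n
    proof -
      have X: "cmod (cnj w ^ n / fact n) = cmod w ^ n / fact n"
        by (simp add: norm_divide norm_power)
      have Y: "((cmod w)\<^sup>2) ^ n = (cmod w ^ n)\<^sup>2"
        by (metis power_mult mult.commute)
      show ?thesis
        unfolding X Y power_divide by (simp add: power2_eq_square[of "fact n"] field_simps)
    qed
  qed
  with summable_exp_generic[of "(cmod w)\<^sup>2"]
  show ?thesis by (subst fock_space_iff_summable(1)[OF fock_kernel_sums]) simp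
qed

text \<open>The weight n! in the coefficient formula cancels the 1/n! in the coefficients of the
  kernel, leaving the Taylor series of \<open>f\<close> at \<open>w\<close>.\<close>

lemma fock_inner_kernel:
  assumes "f \<in> fock_space"
  shows "fock_inner f (fock_kernel w) = f w"
proof -
  have c: "\<And>z. (\<lambda>n. fock_coeff f n * z ^ n) sums f z"
    using assms fock_coeff_sums fock_space_holomorphic by blast
  from fock_inner_sums[OF c fock_kernel_sums assms fock_kernel_in_fock_space]
  have "(\<lambda>n. fock_coeff f n * w ^ n) sums fock_inner f (fock_kernel w)"
    by simp
  then show ?thesis using c[of w] by (rule sums_unique2)
qed

lemma fock_norm_kernel_sq: "(fock_norm (fock_kernel w))\<^sup>2 = exp ((cmod w)\<^sup>2)"
proof -
  have "complex_of_real ((fock_norm (fock_kernel w))\<^sup>2) = fock_kernel w w"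
    by (simp only: fock_inner_kernel fock_kernel_in_fock_space flip: fock_inner_self)
  also have "\<dots> = exp (complex_of_real ((cmod w)\<^sup>2))"
    unfolding complex_norm_square fock_kernel_def by (simp add: mult.commute)
  also have "\<dots> = complex_of_real (exp ((cmod w)\<^sup>2))"
    by (rule exp_of_real)
  finally show ?thesis by (simp only: of_real_eq_iff)
qed

lemma fock_cauchy_schwarz:
  assumes f: "f \<in> fock_space" and g: "g \<in> fock_space"
  shows "cmod (fock_inner f g) \<le> fock_norm f * fock_norm g"
proof (cases "fock_norm g = 0")
  case True
  then show ?thesis
    using fock_norm_eq_0[OF g] by (simp add: fock_inner_def)
next
  case False
  \<comment> \<open>This is the coefficient of the orthogonal projection of \<open>f\<close> onto
    \<open>g\<close>; nonnegativity of the squared norm of the remainder \<open>?h\<close> is the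
    inequality.\<close>
  define t where "t = fock_inner f g / of_real ((fock_norm g)\<^sup>2)"
  let ?h = "\<lambda>z. f z - t * g z"
  have h: "?h \<in> fock_space" by (intro fock_space_diff fock_space_cmult f g)
  have "fock_inner ?h g = 0"
    unfolding fock_inner_diff_left[OF f fock_space_cmult[OF g] g] fock_inner_cmult_left fock_inner_self
    using False by (simp add: t_def)
  then have "fock_inner ?h ?h = fock_inner ?h f"
    by (simp add: fock_inner_diff_right[OF f fock_space_cmult[OF g] h] fock_inner_cmult_right)
  also have "\<dots> = of_real ((fock_norm f)\<^sup>2) - t * cnj (fock_inner f g)"
    by (simp add: fock_inner_diff_left[OF f fock_space_cmult[OF g] f] fock_inner_cmult_left fock_inner_self fock_inner_commute[of g])
  also have "t * cnj (fock_inner f g) = of_real ((cmod (fock_inner f g))\<^sup>2 / (fock_norm g)\<^sup>2)"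
    by (simp add: t_def complex_norm_square del: of_real_power)
  finally have "(fock_norm ?h)\<^sup>2 = (fock_norm f)\<^sup>2 - (cmod (fock_inner f g))\<^sup>2 / (fock_norm g)\<^sup>2"
    unfolding fock_inner_self by (simp only: of_real_diff[symmetric] of_real_eq_iff)
  then have "(cmod (fock_inner f g))\<^sup>2 / (fock_norm g)\<^sup>2 \<le> (fock_norm f)\<^sup>2"
    by (metis diff_ge_0_iff_ge zero_le_power2)
  then have "(cmod (fock_inner f g))\<^sup>2 \<le> (fock_norm f * fock_norm g)\<^sup>2"
    using False by (simp add: pos_divide_le_eq power_mult_distrib)
  then show ?thesis by (rule power2_le_imp_le) simp
qed

section \<open>Adjoints\<close>

text \<open>Subtracting a Taylor polynomial removes the first \<open>N\<close> coefficients, so the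
  squared norm of the remainder is a tail of a convergent series. This is how polynomials
  approximate in norm.\<close>

lemma fock_space_minus_polynomial:
  assumes c: "\<And>z. (\<lambda>n. c n * z ^ n) sums f z" and f: "f \<in> fock_space"
  shows "(\<lambda>z. f z - (\<Sum>n<N. c n * z ^ n)) \<in> fock_space"
    and "(fock_norm (\<lambda>z. f z - (\<Sum>n<N. c n * z ^ n)))\<^sup>2 = (fock_norm f)\<^sup>2 - (\<Sum>n<N. fact n * (cmod (c n))\<^sup>2)"
proof -
  let ?r = "\<lambda>z. f z - (\<Sum>n<N. c n * z ^ n)"
  have r: "(\<lambda>n. (if n < N then 0 else c n) * z ^ n) sums ?r z" for z
    using sums_diff[OF c[of z] sums_If_finite_set[of "{..<N}" "\<lambda>n. c n * z ^ n"]]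
    by (rule sums_cong[THEN iffD1, rotated]) auto
  have "(\<lambda>n. fact n * (cmod (c n))\<^sup>2 - (if n \<in> {..<N} then fact n * (cmod (c n))\<^sup>2 else 0))
      sums ((fock_norm f)\<^sup>2 - (\<Sum>n<N. fact n * (cmod (c n))\<^sup>2))"
    by (intro sums_diff fock_norm_sums[OF c f] sums_If_finite_set) simp
  then have s: "(\<lambda>n. fact n * (cmod (if n < N then 0 else c n))\<^sup>2)
      sums ((fock_norm f)\<^sup>2 - (\<Sum>n<N. fact n * (cmod (c n))\<^sup>2))"
    by (rule sums_cong[THEN iffD1, rotated]) auto
  then show "?r \<in> fock_space"
    unfolding fock_space_iff_summable(1)[OF r] by (rule sums_summable)
  then show "(fock_norm ?r)\<^sup>2 = (fock_norm f)\<^sup>2 - (\<Sum>n<N. fact n * (cmod (c n))\<^sup>2)"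
    using fock_norm_sums[OF r] s sums_unique2 by blast
qed

lemma fock_polynomial:
  shows "(\<lambda>z. \<Sum>n<N. c n * z ^ n) \<in> fock_space"
    and "(fock_norm (\<lambda>z. \<Sum>n<N. c n * z ^ n))\<^sup>2 = (\<Sum>n<N. fact n * (cmod (c n))\<^sup>2)"
proof -
  have p: "(\<lambda>n. (if n < N then c n else 0) * z ^ n) sums (\<Sum>n<N. c n * z ^ n)" for z
    using sums_If_finite_set[of "{..<N}" "\<lambda>n. c n * z ^ n"]
    by (rule sums_cong[THEN iffD1, rotated]) auto
  have s: "(\<lambda>n. fact n * (cmod (if n < N then c n else 0))\<^sup>2) sums (\<Sum>n<N. fact n * (cmod (c n))\<^sup>2)"
    using sums_If_finite_set[of "{..<N}" "\<lambda>n. fact n * (cmod (c n))\<^sup>2"]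
    by (rule sums_cong[THEN iffD1, rotated]) auto
  then show "(\<lambda>z. \<Sum>n<N. c n * z ^ n) \<in> fock_space"
    unfolding fock_space_iff_summable(1)[OF p] by (rule sums_summable)
  then show "(fock_norm (\<lambda>z. \<Sum>n<N. c n * z ^ n))\<^sup>2 = (\<Sum>n<N. fact n * (cmod (c n))\<^sup>2)"
    using fock_norm_sums[OF p] s sums_unique2 by blast
qed

lemma fock_monomial: "(\<lambda>z. z ^ n) \<in> fock_space"
  using fock_polynomial(1)[of "\<lambda>k. if k = n then 1 else 0" "Suc n"]
  by (simp add: if_distrib[of "\<lambda>x. x * _"] cong: if_cong)

text \<open>The coefficients of the adjoint are forced by testing against monomials; boundedness
  makes them square summable with weights \<open>n!\<close>.\<close>
lemma fock_adjoint_exists: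
  assumes bdd: "fock_bounded T"
    and add: "\<And>f g. T (\<lambda>z. f z + g z) = (\<lambda>z. T f z + T g z)"
    and cmult: "\<And>c f. T (\<lambda>z. c * f z) = (\<lambda>z. c * T f z)"
  shows "\<exists>S. (\<forall>g\<in>fock_space. S g \<in> fock_space) \<and>
     (\<forall>f\<in>fock_space. \<forall>g\<in>fock_space. fock_inner (T f) g = fock_inner f (S g))"
proof -
  obtain M0 where TF: "\<And>f. f \<in> fock_space \<Longrightarrow> T f \<in> fock_space"
    and M0: "\<And>f. f \<in> fock_space \<Longrightarrow> fock_norm (T f) \<le> M0 * fock_norm f"
    using bdd by (auto simp: fock_bounded_def)
  \<comment> \<open>Boundedness as defined does not ask for a nonnegative constant; one is used
    below when the norm of a test polynomial is zero.\<close>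
  define M where "M = max M0 0"
  have "M \<ge> 0" by (simp add: M_def)
  have M: "fock_norm (T f) \<le> M * fock_norm f" if "f \<in> fock_space" for f
    using M0[OF that] by (rule order_trans) (auto simp: M_def intro!: mult_right_mono)
  have "\<exists>h\<in>fock_space. \<forall>f\<in>fock_space. fock_inner (T f) g = fock_inner f h" if g: "g \<in> fock_space" for g
  proof -
    define t where "t n = fock_inner (T (\<lambda>z. z ^ n)) g" for n
    have T_poly: "fock_inner (T (\<lambda>z. \<Sum>n<N. c n * z ^ n)) g = (\<Sum>n<N. c n * t n)" for c N
    proof (induction N)
      case 0
      show ?case using cmult[of 0 "\<lambda>_. 0"] by (simp add: fock_inner_def)
    next
      case (Suc N)
      then show ?case
        by (simp add: add cmult fock_inner_add_left fock_inner_cmult_left fock_space_cmult TF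
            fock_polynomial fock_monomial g t_def)
    qed
    have Tg: "cmod (fock_inner (T f) g) \<le> M * fock_norm f * fock_norm g" if "f \<in> fock_space" for f
      using fock_cauchy_schwarz[OF TF[OF that] g] mult_right_mono[OF M[OF that], of "fock_norm g"]
      by simp
    \<comment> \<open>Forced by \<open>t n\<close>, which must equal the inner product of the
      monomial with the sought \<open>h\<close>, that is \<open>fact n * cnj (d n)\<close>.\<close>
    define d where "d n = cnj (t n) / fact n" for n
    have t_eq: "t n = fact n * cnj (d n)" for n
      by (simp add: d_def)
    have "(\<Sum>n<N. fact n * (cmod (d n))\<^sup>2) \<le> (M * fock_norm g)\<^sup>2" for N
    proof -
      \<comment> \<open>Testing with the partial sum of \<open>h\<close> itself makes the inner
        product of \<open>T ?p\<close> with \<open>g\<close> equal to the squared norm of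
        \<open>?p\<close>; dividing by that norm bounds it independently of
        \<open>N\<close>.\<close>
      let ?p = "\<lambda>z. \<Sum>n<N. d n * z ^ n"
      have "fock_inner (T ?p) g = of_real ((fock_norm ?p)\<^sup>2)"
        unfolding T_poly fock_polynomial(2) of_real_sum
        by (intro sum.cong refl) (simp add: t_eq complex_norm_square mult_ac del: of_real_power)
      then have "(fock_norm ?p)\<^sup>2 \<le> M * fock_norm ?p * fock_norm g"
        using Tg[of ?p] fock_polynomial(1)[of d N] by (simp del: of_real_power)
      then have "fock_norm ?p * fock_norm ?p \<le> fock_norm ?p * (M * fock_norm g)"
        by (simp add: power2_eq_square mult_ac)
      then have "fock_norm ?p \<le> M * fock_norm g"
      proof (cases "fock_norm ?p = 0")
        case False
        then have "fock_norm ?p > 0" using fock_norm_nonneg[of ?p] by linarith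
        with \<open>fock_norm ?p * fock_norm ?p \<le> fock_norm ?p * (M * fock_norm g)\<close> show ?thesis
          by (rule mult_left_le_imp_le)
      qed (use \<open>M \<ge> 0\<close> in simp)
      then show ?thesis
        unfolding fock_polynomial(2)[symmetric] by (intro power_mono) simp_all
    qed
    then have summ: "summable (\<lambda>n. fact n * (cmod (d n))\<^sup>2)"
      by (intro summableI_nonneg_bounded) simp_all
    define h where "h z = (\<Sum>n. d n * z ^ n)" for z
    have h: "(\<lambda>n. d n * z ^ n) sums h z" for z
      unfolding h_def by (intro summable_sums fock_power_series summ)
    have hF: "h \<in> fock_space"
      using summ unfolding fock_space_iff_summable(1)[OF h] .
    moreover have "fock_inner (T f) g = fock_inner f h" if f: "f \<in> fock_space" for f
    proof -
      define c where "c = fock_coeff f"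
      have c: "\<And>z. (\<lambda>n. c n * z ^ n) sums f z"
        unfolding c_def using f fock_coeff_sums fock_space_holomorphic by blast
      let ?p = "\<lambda>N z. \<Sum>n<N. c n * z ^ n"
      have "(\<lambda>N. sqrt ((fock_norm f)\<^sup>2 - (\<Sum>n<N. fact n * (cmod (c n))\<^sup>2)))
          \<longlonglongrightarrow> sqrt ((fock_norm f)\<^sup>2 - (fock_norm f)\<^sup>2)"
        using fock_norm_sums[OF c f] unfolding sums_def by (intro tendsto_intros)
      then have "(\<lambda>N. fock_norm (\<lambda>z. f z - ?p N z)) \<longlonglongrightarrow> 0"
        unfolding fock_space_minus_polynomial(2)[OF c f, symmetric] by simp
      then have bound0: "(\<lambda>N. M * fock_norm (\<lambda>z. f z - ?p N z) * fock_norm g) \<longlonglongrightarrow> 0"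
        using tendsto_mult[OF tendsto_mult[OF tendsto_const[of M]] tendsto_const[of "fock_norm g"]] by fastforce
      have lim0: "(\<lambda>N. fock_inner (T (?p N)) g - fock_inner (T f) g) \<longlonglongrightarrow> 0"
      proof (rule Lim_null_comparison[OF always_eventually[OF allI] bound0])
        show "norm (fock_inner (T (?p N)) g - fock_inner (T f) g)
          \<le> M * fock_norm (\<lambda>z. f z - ?p N z) * fock_norm g" for N
        proof -
          have "T f = T (\<lambda>z. (f z - ?p N z) + ?p N z)" by simp
          also have "\<dots> = (\<lambda>z. T (\<lambda>z. f z - ?p N z) z + T (?p N) z)" by (rule add)
          finally have Tf: "T f = (\<lambda>z. T (\<lambda>z. f z - ?p N z) z + T (?p N) z)" .
          have "fock_inner (T f) g = fock_inner (T (\<lambda>z. f z - ?p N z)) g + fock_inner (T (?p N)) g"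
            unfolding Tf
            by (intro fock_inner_add_left TF fock_space_minus_polynomial(1)[OF c f] fock_polynomial(1) g)
          then show ?thesis
            using Tg[OF fock_space_minus_polynomial(1)[OF c f], of N] by (simp add: norm_minus_commute)
        qed
      qed
      have "(\<lambda>N. fock_inner (T (?p N)) g) \<longlonglongrightarrow> fock_inner (T f) g"
        by (rule LIM_zero_cancel[OF lim0])
      then have "(\<lambda>n. c n * t n) sums fock_inner (T f) g"
        unfolding sums_def T_poly .
      moreover have "(\<lambda>n. c n * t n) sums fock_inner f h"
        using fock_inner_sums[OF c h f hF] by (simp add: t_eq mult_ac)
      ultimately show ?thesis by (rule sums_unique2)
    qed
    ultimately show ?thesis by blast
  qed
  then show ?thesis by metis
qed

text \<open>Once some adjoint exists, the \<open>SOME\<close> in the definition picks a genuine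
  one.\<close>

lemma fock_adjoint_spec:
  assumes "\<exists>S. (\<forall>g\<in>fock_space. S g \<in> fock_space) \<and>
     (\<forall>f\<in>fock_space. \<forall>g\<in>fock_space. fock_inner (T f) g = fock_inner f (S g))"
  shows "g \<in> fock_space \<Longrightarrow> fock_adjoint T g \<in> fock_space"
    and "f \<in> fock_space \<Longrightarrow> g \<in> fock_space \<Longrightarrow> fock_inner (T f) g = fock_inner f (fock_adjoint T g)"
  using someI_ex[OF assms] unfolding fock_adjoint_def by blast+

text \<open>Testing the adjoint relation on kernels recovers point values, so any two adjoints agree
  on the space. Outside it the chosen adjoint is unconstrained, hence the restriction on
  \<open>g\<close>.\<close>

lemma fock_adjoint_eq:
  assumes S: "\<And>g. g \<in> fock_space \<Longrightarrow> S g \<in> fock_space"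
    and adj: "\<And>f g. f \<in> fock_space \<Longrightarrow> g \<in> fock_space \<Longrightarrow> fock_inner (T f) g = fock_inner f (S g)"
    and g: "g \<in> fock_space"
  shows "fock_adjoint T g = S g"
proof
  fix w
  have ex: "\<exists>S. (\<forall>g\<in>fock_space. S g \<in> fock_space) \<and>
     (\<forall>f\<in>fock_space. \<forall>g\<in>fock_space. fock_inner (T f) g = fock_inner f (S g))"
    using S adj by blast
  note A = fock_adjoint_spec[OF ex]
  have "fock_inner (fock_kernel w) (fock_adjoint T g) = fock_inner (fock_kernel w) (S g)"
    using A(2)[OF _ g] adj[OF _ g] by (metis fock_kernel_in_fock_space)
  then have "fock_inner (fock_adjoint T g) (fock_kernel w) = fock_inner (S g) (fock_kernel w)"
    by (metis fock_inner_commute)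
  then show "fock_adjoint T g w = S g w"
    using A(1)[OF g] S[OF g] by (simp add: fock_inner_kernel)
qed

section \<open>Cohyponormality, boundedness and weighted composition operators\<close>

text \<open>When \<open>T\<close> commutes with its adjoint on the space, the two quadratic forms
  coincide, so their difference is zero.\<close>

lemma fock_cohyponormal_if_normal:
  assumes T: "\<And>g. g \<in> fock_space \<Longrightarrow> T g \<in> fock_space"
    and S: "\<And>g. g \<in> fock_space \<Longrightarrow> S g \<in> fock_space"
    and adj: "\<And>f g. f \<in> fock_space \<Longrightarrow> g \<in> fock_space \<Longrightarrow> fock_inner (T f) g = fock_inner f (S g)"
    and comm: "\<And>f. f \<in> fock_space \<Longrightarrow> T (S f) = S (T f)"
  shows "fock_cohyponormal T"
  using T comm by (simp add: fock_cohyponormal_def fock_op_le_def fock_adjoint_eq[OF S adj])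

text \<open>The reproducing property turns the inner product of the image of \<open>f\<close> with
  the kernel at \<open>w\<close> into \<psi>(w) f(\<phi>(w)), again an evaluation. Taking kernels
  for \<open>f\<close> gives the values of the adjoint.\<close>

lemma fock_adjoint_wcomp_kernel:
  assumes ex: "\<exists>S. (\<forall>g\<in>fock_space. S g \<in> fock_space) \<and>
     (\<forall>f\<in>fock_space. \<forall>g\<in>fock_space. fock_inner (wcomp \<psi> \<phi> f) g = fock_inner f (S g))"
    and T: "\<And>f. f \<in> fock_space \<Longrightarrow> wcomp \<psi> \<phi> f \<in> fock_space"
  shows "fock_adjoint (wcomp \<psi> \<phi>) (fock_kernel w) = (\<lambda>z. cnj (\<psi> w) * fock_kernel (\<phi> w) z)"
proof
  fix u
  have "fock_adjoint (wcomp \<psi> \<phi>) (fock_kernel w) u = fock_inner (fock_adjoint (wcomp \<psi> \<phi>) (fock_kernel w)) (fock_kernel u)"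
    by (simp add: fock_inner_kernel fock_adjoint_spec[OF ex])
  also have "\<dots> = cnj (fock_inner (wcomp \<psi> \<phi> (fock_kernel u)) (fock_kernel w))"
    by (subst fock_inner_commute) (simp add: fock_adjoint_spec(2)[OF ex])
  also have "\<dots> = cnj (wcomp \<psi> \<phi> (fock_kernel u) w)"
    by (simp add: fock_inner_kernel T)
  also have "\<dots> = cnj (\<psi> w) * fock_kernel (\<phi> w) u"
    by (simp add: wcomp_def fock_kernel_def exp_cnj mult.commute)
  finally show "fock_adjoint (wcomp \<psi> \<phi>) (fock_kernel w) u = cnj (\<psi> w) * fock_kernel (\<phi> w) u" .
qed

text \<open>The kernel at a fixed point is an eigenvector of the adjoint, and cohyponormality
  transfers this to the operator itself. The resulting functional equation determines \<psi> when
  \<open>a \<noteq> 1\<close>.\<close>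

lemma fock_cohyponormal_wcomp_fixpoint:
  assumes bdd: "fock_bounded (wcomp \<psi> \<phi>)" and coh: "fock_cohyponormal (wcomp \<psi> \<phi>)"
    and p: "\<phi> p = p"
  shows "wcomp \<psi> \<phi> (fock_kernel p) = (\<lambda>z. \<psi> p * fock_kernel p z)"
proof -
  let ?T = "wcomp \<psi> \<phi>" and ?K = "fock_kernel p"
  have TF: "\<And>f. f \<in> fock_space \<Longrightarrow> ?T f \<in> fock_space"
    using bdd by (auto simp: fock_bounded_def)
  have ex: "\<exists>S. (\<forall>g\<in>fock_space. S g \<in> fock_space) \<and>
     (\<forall>f\<in>fock_space. \<forall>g\<in>fock_space. fock_inner (?T f) g = fock_inner f (S g))"
    by (rule fock_adjoint_exists[OF bdd]) (auto simp: wcomp_def algebra_simps)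
  let ?S = "fock_adjoint ?T"
  note S = fock_adjoint_spec[OF ex]
  have SK: "?S ?K = (\<lambda>z. cnj (\<psi> p) * ?K z)"
    using fock_adjoint_wcomp_kernel[OF ex TF, of p] p by simp
  have TK: "fock_inner (?T ?K) ?K = \<psi> p * of_real ((fock_norm ?K)\<^sup>2)"
    by (subst S(2)) (simp_all add: SK fock_inner_cmult_right fock_inner_self)
  have "Re (fock_inner (?S (?T ?K)) ?K) \<le> Re (fock_inner (?T (?S ?K)) ?K)"
    using coh by (auto simp: fock_cohyponormal_def fock_op_le_def)
  moreover have "fock_inner (?S (?T ?K)) ?K = of_real ((fock_norm (?T ?K))\<^sup>2)"
    by (subst fock_inner_commute, subst S(2)[symmetric]) (simp_all add: TF fock_inner_self)
  moreover have "fock_inner (?T (?S ?K)) ?K = of_real ((cmod (\<psi> p))\<^sup>2 * (fock_norm ?K)\<^sup>2)"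
    by (subst S(2)) (simp_all add: SK fock_space_cmult fock_inner_cmult_left fock_inner_cmult_right
        fock_inner_self complex_norm_square mult_ac del: of_real_power)
  ultimately have le: "(fock_norm (?T ?K))\<^sup>2 \<le> (cmod (\<psi> p))\<^sup>2 * (fock_norm ?K)\<^sup>2"
    by (simp del: of_real_power of_real_mult)
  let ?h = "\<lambda>z. ?T ?K z - \<psi> p * ?K z"
  have h: "?h \<in> fock_space"
    by (intro fock_space_diff fock_space_cmult TF) simp_all
  \<comment> \<open>The eigenvector relation \<open>SK\<close> enters through \<open>TK\<close>:
    both mixed terms equal |\<psi>(p)|^2 times the squared norm of \<open>?K\<close>, and one of
    them cancels the last term.\<close>
  have "fock_inner ?h ?h = of_real ((fock_norm (?T ?K))\<^sup>2 - (cmod (\<psi> p))\<^sup>2 * (fock_norm ?K)\<^sup>2)"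
  proof -
    have K: "(\<lambda>z. \<psi> p * ?K z) \<in> fock_space" by (simp add: fock_space_cmult)
    have "fock_inner ?h ?h = fock_inner (?T ?K) (?T ?K) - cnj (\<psi> p) * fock_inner (?T ?K) ?K
        - (\<psi> p * fock_inner ?K (?T ?K) - \<psi> p * (cnj (\<psi> p) * fock_inner ?K ?K))"
      using TF[of ?K] K h
      by (simp add: fock_inner_diff_left fock_inner_diff_right fock_inner_cmult_left fock_inner_cmult_right right_diff_distrib)
    also have "fock_inner ?K (?T ?K) = cnj (\<psi> p) * of_real ((fock_norm ?K)\<^sup>2)"
      using TK by (subst fock_inner_commute) simp
    finally show ?thesis
      unfolding TK fock_inner_self of_real_diff of_real_mult complex_norm_square by (simp add: algebra_simps)
  qed
  then have "(fock_norm ?h)\<^sup>2 = (fock_norm (?T ?K))\<^sup>2 - (cmod (\<psi> p))\<^sup>2 * (fock_norm ?K)\<^sup>2"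
    unfolding fock_inner_self by (simp only: of_real_eq_iff)
  with le have "(fock_norm ?h)\<^sup>2 \<le> 0" by linarith
  then have "fock_norm ?h = 0" by simp
  from fock_norm_eq_0[OF h this] show ?thesis by (auto simp: fun_eq_iff)
qed

text \<open>Kernels are test functions: the norm bound controls the growth of \<psi> so precisely
  that its quotient by the claimed kernel is bounded, and Liouville makes it constant.\<close>

lemma fock_bounded_translation:
  assumes hol: "\<psi> holomorphic_on UNIV" and bdd: "fock_bounded (wcomp \<psi> (\<lambda>z. z + b))"
  shows "\<psi> = (\<lambda>z. \<psi> 0 * fock_kernel (- b) z)"
proof -
  let ?T = "wcomp \<psi> (\<lambda>z. z + b)"
  obtain M where TF: "\<And>f. f \<in> fock_space \<Longrightarrow> ?T f \<in> fock_space"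
    and M: "\<And>f. f \<in> fock_space \<Longrightarrow> fock_norm (?T f) \<le> M * fock_norm f"
    using bdd by (auto simp: fock_bounded_def)
  let ?g = "\<lambda>w. \<psi> w * exp (cnj b * w)"
  have nK: "fock_norm (fock_kernel w) = exp ((cmod w)\<^sup>2 / 2)" for w
    using fock_norm_kernel_sq[of w]
    by (metis exp_half_le2 exp_ge_zero fock_norm_nonneg power2_eq_imp_eq exp_double mult.commute
        field_sum_of_halves mult_2 exp_add power2_eq_square)
  have "cmod (?g w) \<le> M * exp (- (cmod b)\<^sup>2 / 2)" for w
  proof -
    \<comment> \<open>This kernel is extremal for evaluation at \<open>w + b\<close>, the point
      where the translation sends \<open>w\<close>.\<close>
    let ?K = "fock_kernel (w + b)"
    have "cmod (?T ?K w) = cmod (fock_inner (?T ?K) (fock_kernel w))"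
      by (simp add: fock_inner_kernel TF)
    also have "\<dots> \<le> fock_norm (?T ?K) * fock_norm (fock_kernel w)"
      by (intro fock_cauchy_schwarz TF) simp_all
    also have "\<dots> \<le> M * fock_norm ?K * fock_norm (fock_kernel w)"
      by (intro mult_right_mono M) simp_all
    also have "?T ?K w = \<psi> w * exp (of_real ((cmod (w + b))\<^sup>2))"
      by (simp only: wcomp_def fock_kernel_def complex_norm_square mult.commute)
    finally have "cmod (\<psi> w) * exp ((cmod (w + b))\<^sup>2) \<le> M * exp ((cmod (w + b))\<^sup>2 / 2) * exp ((cmod w)\<^sup>2 / 2)"
      by (simp add: nK norm_mult flip: exp_of_real)
    \<comment> \<open>The factor is chosen to turn the left side into the modulus of
      \<open>?g w\<close>; on the right all dependence on \<open>w\<close> cancels, since |w + b|^2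
      = |w|^2 + |b|^2 + 2 Re(cnj b w).\<close>
    then have "cmod (\<psi> w) * exp ((cmod (w + b))\<^sup>2) * exp (- (cmod (w + b))\<^sup>2 + Re (cnj b * w))
        \<le> M * exp ((cmod (w + b))\<^sup>2 / 2) * exp ((cmod w)\<^sup>2 / 2) * exp (- (cmod (w + b))\<^sup>2 + Re (cnj b * w))"
      by (rule mult_right_mono) simp
    also have "\<dots> = M * exp ((cmod (w + b))\<^sup>2 / 2 + (cmod w)\<^sup>2 / 2 + (- (cmod (w + b))\<^sup>2 + Re (cnj b * w)))"
      by (simp only: exp_add mult.assoc)
    also have "(cmod (w + b))\<^sup>2 / 2 + (cmod w)\<^sup>2 / 2 + (- (cmod (w + b))\<^sup>2 + Re (cnj b * w)) = - (cmod b)\<^sup>2 / 2"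
      by (simp add: cmod_power2) (simp add: power2_eq_square field_simps)
    also have "cmod (\<psi> w) * exp ((cmod (w + b))\<^sup>2) * exp (- (cmod (w + b))\<^sup>2 + Re (cnj b * w)) = cmod (?g w)"
      by (simp add: norm_mult exp_minus flip: exp_add)
    finally show ?thesis .
  qed
  then have "bounded (range ?g)"
    by (auto simp: bounded_iff)
  then have "?g constant_on UNIV"
    by (intro Liouville_theorem holomorphic_intros hol)
  then obtain k where k: "\<And>w. ?g w = k"
    by (auto simp: constant_on_def)
  have "\<psi> z = \<psi> 0 * fock_kernel (- b) z" for z
    using k[of z] k[of 0] by (simp add: fock_kernel_def exp_minus field_simps)
  then show ?thesis by blast
qed

section \<open>Translations and dilations\<close>

text \<open>The Weyl translation without the factor exp(-|p|^2/2) that would make it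
  unitary.\<close>

definition fock_shift :: "complex \<Rightarrow> fock_op" where
  "fock_shift p f = (\<lambda>z. fock_kernel p z * f (z - p))"

definition fock_dilate :: "complex \<Rightarrow> fock_op" where
  "fock_dilate a f = (\<lambda>z. f (a * z))"

lemma fock_shift_cmult: "fock_shift p (\<lambda>z. c * f z) = (\<lambda>z. c * fock_shift p f z)"
  by (simp add: fock_shift_def mult.left_commute)

lemma fock_dilate_cmult: "fock_dilate a (\<lambda>z. c * f z) = (\<lambda>z. c * fock_dilate a f z)"
  by (simp add: fock_dilate_def)

lemma fock_dilate_dilate: "fock_dilate a (fock_dilate b f) = fock_dilate (a * b) f"
  by (simp add: fock_dilate_def mult_ac)

text \<open>The product of the two kernel factors is constant; its value exp(|p|^2) compensates for
  the omitted normalization.\<close>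

lemma fock_shift_inverse:
  "fock_shift (- p) (fock_shift p f) = (\<lambda>z. of_real (exp ((cmod p)\<^sup>2)) * f z)"
proof
  fix z
  have "fock_kernel (- p) z * fock_kernel p (z + p) = exp (of_real ((cmod p)\<^sup>2))"
    unfolding complex_norm_square fock_kernel_def exp_add[symmetric] by (simp add: algebra_simps)
  then show "fock_shift (- p) (fock_shift p f) z = of_real (exp ((cmod p)\<^sup>2)) * f z"
    by (simp add: fock_shift_def mult.assoc[symmetric] exp_of_real del: of_real_power)
qed

lemma lborel_integral_shift:
  fixes f :: "'a::euclidean_space \<Rightarrow> 'b::{banach, second_countable_topology}"
  assumes "f \<in> borel_measurable borel"
  shows "(LINT x|lborel. f (x + t)) = (LINT x|lborel. f x)"
    and "integrable lborel f \<Longrightarrow> integrable lborel (\<lambda>x. f (x + t))"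
proof -
  have "(LINT x|lborel. f x) = (LINT x|distr lborel borel ((+) t). f x)"
    by (simp only: lborel_distr_plus)
  also have "\<dots> = (LINT x|lborel. f (t + x))"
    using assms by (intro integral_distr) auto
  finally show "(LINT x|lborel. f (x + t)) = (LINT x|lborel. f x)" by (simp add: add.commute)
  assume "integrable lborel f"
  then have "integrable (distr lborel borel ((+) t)) f"
    by (simp only: lborel_distr_plus)
  then have "integrable lborel (\<lambda>x. f (t + x))"
    by (rule integrable_distr[rotated]) simp
  then show "integrable lborel (\<lambda>x. f (x + t))"
    by (simp add: add.commute)
qed

lemma fock_measure_integrable_iff:
  fixes f :: "complex \<Rightarrow> 'b::{banach, second_countable_topology}"
  assumes "f \<in> borel_measurable borel"
  shows "integrable fock_measure f \<longleftrightarrow> integrable lborel (\<lambda>z. (exp (- (cmod z)\<^sup>2) / pi) *\<^sub>R f z)"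
  unfolding fock_measure_def using assms by (intro integrable_density) auto

lemma fock_measure_integral_eq:
  fixes f :: "complex \<Rightarrow> 'b::{banach, second_countable_topology}"
  assumes "f \<in> borel_measurable borel"
  shows "(LINT z|fock_measure. f z) = (LINT z|lborel. (exp (- (cmod z)\<^sup>2) / pi) *\<^sub>R f z)"
  unfolding fock_measure_def using assms by (intro integral_density) auto

text \<open>Completing the square, exp(|p|^2) times the Gaussian weight translated by
  \<open>p\<close> is the weight times the squared modulus of the kernel, so translation invariance
  of Lebesgue measure suffices.\<close>

lemma fock_shift_in_fock_space:
  assumes "f \<in> fock_space"
  shows "fock_shift p f \<in> fock_space"
proof -
  have hol: "f holomorphic_on UNIV" using assms by (rule fock_space_holomorphic)
  have shol: "fock_shift p f holomorphic_on UNIV"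
    unfolding fock_shift_def fock_kernel_def
    by (intro holomorphic_intros holomorphic_on_compose_gen[OF _ hol, unfolded o_def]) auto
  have [measurable]: "f \<in> borel_measurable borel" "fock_shift p f \<in> borel_measurable borel"
    by (intro borel_measurable_continuous_onI holomorphic_on_imp_continuous_on hol shol)+
  let ?w = "\<lambda>z. exp (- (cmod z)\<^sup>2) / pi"
  have "integrable lborel (\<lambda>z. ?w z *\<^sub>R (cmod (f z))\<^sup>2)"
    using assms by (subst fock_measure_integrable_iff[symmetric]) (auto simp: fock_space_def)
  then have "integrable lborel (\<lambda>z. ?w (z + - p) *\<^sub>R (cmod (f (z + - p)))\<^sup>2)"
    by (rule lborel_integral_shift(2)[rotated]) simp
  then have "integrable lborel (\<lambda>z. exp ((cmod p)\<^sup>2) * (?w (z + - p) *\<^sub>R (cmod (f (z + - p)))\<^sup>2))"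
    by (rule integrable_mult_right)
  also have "(\<lambda>z. exp ((cmod p)\<^sup>2) * (?w (z + - p) *\<^sub>R (cmod (f (z + - p)))\<^sup>2))
      = (\<lambda>z. ?w z *\<^sub>R (cmod (fock_shift p f z))\<^sup>2)"
  proof
    fix z
    have "exp ((cmod p)\<^sup>2) * exp (- (cmod (z + - p))\<^sup>2) = exp (- (cmod z)\<^sup>2) * (cmod (fock_kernel p z))\<^sup>2"
      unfolding fock_kernel_def norm_exp_eq_Re exp_double[symmetric] exp_add[symmetric]
      by (simp add: cmod_power2) (simp add: power2_eq_square algebra_simps)
    then show "exp ((cmod p)\<^sup>2) * (?w (z + - p) *\<^sub>R (cmod (f (z + - p)))\<^sup>2)
      = ?w z *\<^sub>R (cmod (fock_shift p f z))\<^sup>2"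
      by (simp add: fock_shift_def norm_mult power_mult_distrib mult.assoc[symmetric])
  qed
  finally have "integrable fock_measure (\<lambda>z. (cmod (fock_shift p f z))\<^sup>2)"
    by (subst fock_measure_integrable_iff) auto
  with shol show ?thesis by (simp add: fock_space_def)
qed

text \<open>Substituting z + p for z and completing the square moves the kernel factor to the other
  argument. By \<open>fock_shift_inverse\<close> the adjoint is thus a multiple of the
  inverse.\<close>

lemma fock_inner_shift:
  assumes f: "f \<in> fock_space" and g: "g \<in> fock_space"
  shows "fock_inner (fock_shift p f) g = fock_inner f (fock_shift (- p) g)"
proof -
  note [measurable] = f[THEN fock_space_borel_measurable] g[THEN fock_space_borel_measurable]
    f[THEN fock_shift_in_fock_space, THEN fock_space_borel_measurable, of p]
    g[THEN fock_shift_in_fock_space, THEN fock_space_borel_measurable, of "- p"]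
  have [measurable]: "cnj \<in> borel_measurable borel"
    by (intro borel_measurable_continuous_onI continuous_intros)
  let ?w = "\<lambda>z. exp (- (cmod z)\<^sup>2) / pi"
  have "fock_inner (fock_shift p f) g = (LINT z|lborel. ?w z *\<^sub>R (fock_shift p f z * cnj (g z)))"
    unfolding fock_inner_def by (rule fock_measure_integral_eq) measurable
  also have "\<dots> = (LINT z|lborel. ?w (z + p) *\<^sub>R (fock_shift p f (z + p) * cnj (g (z + p))))"
    by (rule lborel_integral_shift(1)[symmetric]) measurable
  also have "\<dots> = (LINT z|lborel. ?w z *\<^sub>R (f z * cnj (fock_shift (- p) g z)))"
  proof (intro Bochner_Integration.integral_cong refl)
    fix z
    have "of_real (- (cmod (z + p))\<^sup>2) + cnj p * (z + p) = of_real (- (cmod z)\<^sup>2) + cnj (- cnj p * z)"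
      unfolding of_real_minus complex_norm_square by (simp add: algebra_simps)
    then have "of_real (exp (- (cmod (z + p))\<^sup>2)) * fock_kernel p (z + p)
        = of_real (exp (- (cmod z)\<^sup>2)) * cnj (fock_kernel (- p) z)"
      unfolding fock_kernel_def exp_of_real[symmetric] exp_cnj exp_add[symmetric] by simp
    then show "?w (z + p) *\<^sub>R (fock_shift p f (z + p) * cnj (g (z + p)))
        = ?w z *\<^sub>R (f z * cnj (fock_shift (- p) g z))"
      by (simp add: fock_shift_def scaleR_conv_of_real mult_ac)
  qed
  also have "\<dots> = fock_inner f (fock_shift (- p) g)"
    unfolding fock_inner_def by (rule fock_measure_integral_eq[symmetric]) measurable
  finally show ?thesis .
qed

lemma fock_norm_cmult: "fock_norm (\<lambda>z. c * f z) = cmod c * fock_norm f"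
  by (simp add: fock_norm_def norm_mult power_mult_distrib real_sqrt_mult)

text \<open>Moving one shift across the inner product leaves its composition with the opposite
  shift, which is the scalar exp(|p|^2).\<close>

lemma fock_norm_shift:
  assumes "f \<in> fock_space"
  shows "fock_norm (fock_shift p f) = exp ((cmod p)\<^sup>2 / 2) * fock_norm f"
proof -
  have "complex_of_real ((fock_norm (fock_shift p f))\<^sup>2) = of_real (exp ((cmod p)\<^sup>2) * (fock_norm f)\<^sup>2)"
    unfolding fock_inner_self[symmetric] fock_inner_shift[OF assms fock_shift_in_fock_space[OF assms]]
      fock_shift_inverse fock_inner_cmult_right by (simp add: fock_inner_self)
  then have "(fock_norm (fock_shift p f))\<^sup>2 = exp ((cmod p)\<^sup>2) * (fock_norm f)\<^sup>2"
    by (simp only: of_real_eq_iff)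
  also have "\<dots> = (exp ((cmod p)\<^sup>2 / 2) * fock_norm f)\<^sup>2"
    by (simp add: power_mult_distrib flip: exp_double)
  finally show ?thesis by (rule power2_eq_imp_eq) simp_all
qed

section \<open>Dilations as diagonal operators, and normality of the model operators\<close>

lemma fock_dilate_sums:
  assumes "\<And>z. (\<lambda>n. c n * z ^ n) sums f z"
  shows "(\<lambda>n. (c n * a ^ n) * z ^ n) sums fock_dilate a f z"
  using assms[of "a * z"] by (simp add: fock_dilate_def power_mult_distrib mult.assoc)

text \<open>In the monomial basis a dilation is diagonal with entries a^n, all of modulus at most
  1.\<close>

lemma fock_dilate_bound:
  assumes f: "f \<in> fock_space" and a: "cmod a \<le> 1"
  shows "fock_dilate a f \<in> fock_space" and "fock_norm (fock_dilate a f) \<le> fock_norm f"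
proof -
  have c: "\<And>z. (\<lambda>n. fock_coeff f n * z ^ n) sums f z"
    using f fock_coeff_sums fock_space_holomorphic by blast
  note ac = fock_dilate_sums[OF c, of a]
  have le: "fact n * (cmod (fock_coeff f n * a ^ n))\<^sup>2 \<le> fact n * (cmod (fock_coeff f n))\<^sup>2" for n
    using a by (intro mult_left_mono power_mono)
      (auto simp: norm_mult norm_power intro!: mult_left_le power_le_one)
  have "summable (\<lambda>n. fact n * (cmod (fock_coeff f n * a ^ n))\<^sup>2)"
    by (rule summable_comparison_test'[OF sums_summable[OF fock_norm_sums[OF c f]], of 0]) (use le in auto)
  then show D: "fock_dilate a f \<in> fock_space"
    unfolding fock_space_iff_summable(1)[OF ac] .
  have "(fock_norm (fock_dilate a f))\<^sup>2 \<le> (fock_norm f)\<^sup>2"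
    by (rule sums_le[OF le fock_norm_sums[OF ac D] fock_norm_sums[OF c f]])
  then show "fock_norm (fock_dilate a f) \<le> fock_norm f"
    by (rule power2_le_imp_le) simp
qed

text \<open>The adjoint of a diagonal operator has the conjugate entries.\<close>

lemma fock_inner_dilate:
  assumes f: "f \<in> fock_space" and g: "g \<in> fock_space" and a: "cmod a \<le> 1"
  shows "fock_inner (fock_dilate a f) g = fock_inner f (fock_dilate (cnj a) g)"
proof -
  have c: "\<And>z. (\<lambda>n. fock_coeff f n * z ^ n) sums f z" and d: "\<And>z. (\<lambda>n. fock_coeff g n * z ^ n) sums g z"
    using f g fock_coeff_sums fock_space_holomorphic by blast+
  have "(\<lambda>n. fact n * (fock_coeff f n * cnj (fock_coeff g n * cnj a ^ n))) sums fock_inner f (fock_dilate (cnj a) g)"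
    using a by (intro fock_inner_sums c fock_dilate_sums d f fock_dilate_bound g) auto
  moreover have "(\<lambda>n. fact n * (fock_coeff f n * a ^ n * cnj (fock_coeff g n))) sums fock_inner (fock_dilate a f) g"
    using a by (intro fock_inner_sums c fock_dilate_sums d f fock_dilate_bound g) auto
  ultimately show ?thesis
    by (simp add: mult_ac) (metis sums_unique2)
qed

text \<open>For \<open>a \<noteq> 1\<close> the operators in question are scalar multiples of dilations conjugated by the
  translation that moves the origin to the fixed point.\<close>
lemma fock_conjugated_dilation_normal:
  assumes a: "cmod a \<le> 1" and T: "T = (\<lambda>f z. k * fock_shift p (fock_dilate a (fock_shift (- p) f)) z)"
  shows "fock_bounded T" and "fock_cohyponormal T"
proof -
  define S where "S = (\<lambda>f z. cnj k * fock_shift p (fock_dilate (cnj a) (fock_shift (- p) f)) z)"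
  have a': "cmod (cnj a) \<le> 1" using a by simp
  have TF: "T f \<in> fock_space" if "f \<in> fock_space" for f
    unfolding T by (intro fock_space_cmult fock_shift_in_fock_space fock_dilate_bound a that)
  have SF: "S f \<in> fock_space" if "f \<in> fock_space" for f
    unfolding S_def by (intro fock_space_cmult fock_shift_in_fock_space fock_dilate_bound a' that)
  have "fock_norm (T f) \<le> (cmod k * exp ((cmod p)\<^sup>2 / 2) * exp ((cmod p)\<^sup>2 / 2)) * fock_norm f"
    if f: "f \<in> fock_space" for f
  proof -
    have "fock_norm (T f) = cmod k * exp ((cmod p)\<^sup>2 / 2) * fock_norm (fock_dilate a (fock_shift (- p) f))"
      unfolding T fock_norm_cmult
      by (simp add: fock_norm_shift fock_dilate_bound(1) a fock_shift_in_fock_space f)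
    also have "\<dots> \<le> cmod k * exp ((cmod p)\<^sup>2 / 2) * fock_norm (fock_shift (- p) f)"
      by (intro mult_left_mono fock_dilate_bound(2) a fock_shift_in_fock_space f) auto
    finally show ?thesis
      by (simp add: fock_norm_shift f mult.assoc)
  qed
  with TF show "fock_bounded T"
    unfolding fock_bounded_def by blast
  have adj: "fock_inner (T f) g = fock_inner f (S g)" if "f \<in> fock_space" "g \<in> fock_space" for f g
    using that a by (simp add: T S_def fock_inner_cmult_left fock_inner_cmult_right fock_inner_shift
        fock_inner_dilate fock_dilate_bound(1) fock_shift_in_fock_space)
  \<comment> \<open>In either order the inner pair of shifts collapses to a scalar and the dilations
    combine to parameter \<open>a * cnj a\<close>.\<close>
  have comm: "T (S f) = S (T f)" for f
    unfolding T S_def fock_shift_cmult fock_shift_inverse fock_dilate_cmult fock_dilate_dilate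
    by (simp only: mult_ac)
  show "fock_cohyponormal T"
    by (rule fock_cohyponormal_if_normal[OF TF SF adj comm])
qed

text \<open>The adjoint is a multiple of the opposite shift, and opposite shifts compose in either
  order to the same scalar.\<close>

lemma fock_scaled_shift_normal:
  assumes T: "T = (\<lambda>f z. k * fock_shift p f z)"
  shows "fock_bounded T" and "fock_cohyponormal T"
proof -
  define S where "S = (\<lambda>f z. cnj k * fock_shift (- p) f z)"
  have TF: "T f \<in> fock_space" if "f \<in> fock_space" for f
    unfolding T by (intro fock_space_cmult fock_shift_in_fock_space that)
  have SF: "S f \<in> fock_space" if "f \<in> fock_space" for f
    unfolding S_def by (intro fock_space_cmult fock_shift_in_fock_space that)
  have "fock_norm (T f) \<le> (cmod k * exp ((cmod p)\<^sup>2 / 2)) * fock_norm f"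
    if "f \<in> fock_space" for f
    using that by (simp add: T fock_norm_cmult fock_norm_shift)
  with TF show "fock_bounded T"
    unfolding fock_bounded_def by blast
  have adj: "fock_inner (T f) g = fock_inner f (S g)" if "f \<in> fock_space" "g \<in> fock_space" for f g
    using that by (simp add: T S_def fock_inner_cmult_left fock_inner_cmult_right fock_inner_shift)
  have comm: "T (S f) = S (T f)" for f
    unfolding T S_def fock_shift_cmult fock_shift_inverse fock_shift_inverse[of "- p", unfolded minus_minus]
    by (simp only: mult_ac norm_minus_cancel)
  show "fock_cohyponormal T"
    by (rule fock_cohyponormal_if_normal[OF TF SF adj comm])
qed

section \<open>The characterization in the cases \<open>a = 1\<close> and
  \<open>a \<noteq> 1\<close>\<close>

theorem theorem2p6:
  fixes \<psi> :: "complex \<Rightarrow> complex" and a b :: complex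
  assumes "\<psi> holomorphic_on UNIV" and "cmod a \<le> 1"
  shows "(fock_bounded (wcomp \<psi> (\<lambda>z. a * z + b)) \<and>
          fock_cohyponormal (wcomp \<psi> (\<lambda>z. a * z + b)))
     \<longleftrightarrow> (if a \<noteq> 1
          then \<psi> = (\<lambda>z. \<psi> 0 * fock_kernel (b * (cnj a - 1) / (a - 1)) z)
          else \<psi> = (\<lambda>z. \<psi> 0 * fock_kernel (- b) z))"
proof (cases "a = 1")
  case True
  have "fock_bounded (wcomp \<psi> (\<lambda>z. z + b)) \<and> fock_cohyponormal (wcomp \<psi> (\<lambda>z. z + b))"
    if \<psi>: "\<psi> = (\<lambda>z. \<psi> 0 * fock_kernel (- b) z)"
  proof -
    have "wcomp \<psi> (\<lambda>z. z + b) = (\<lambda>f z. \<psi> 0 * fock_shift (- b) f z)"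
      by (subst \<psi>) (simp add: wcomp_def fock_shift_def fun_eq_iff)
    from fock_scaled_shift_normal[OF this] show ?thesis by simp
  qed
  then have "(fock_bounded (wcomp \<psi> (\<lambda>z. z + b)) \<and> fock_cohyponormal (wcomp \<psi> (\<lambda>z. z + b)))
      \<longleftrightarrow> \<psi> = (\<lambda>z. \<psi> 0 * fock_kernel (- b) z)"
    using fock_bounded_translation[OF assms(1)] by blast
  then show ?thesis
    unfolding True by (simp only: mult_1 refl not_True_eq_False if_False)
next
  case False
  \<comment> \<open>The fixed point of the affine map. In terms of it, the index of the kernel in
    the claim becomes \<open>p * (1 - cnj a)\<close>.\<close>
  define p where "p = b / (1 - a)"
  have b: "b = p * (1 - a)" using False by (simp add: p_def)
  have w: "b * (cnj a - 1) / (a - 1) = p * (1 - cnj a)"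
    using False unfolding b by (simp add: field_simps)
  have fixp: "a * p + b = p" by (simp add: b algebra_simps)
  have K: "fock_kernel (p * (1 - cnj a)) z = exp (cnj p * (1 - a) * z)" for z
    by (simp add: fock_kernel_def)
  show ?thesis
  proof (intro iffI)
    assume "fock_bounded (wcomp \<psi> (\<lambda>z. a * z + b)) \<and> fock_cohyponormal (wcomp \<psi> (\<lambda>z. a * z + b))"
    then have e: "wcomp \<psi> (\<lambda>z. a * z + b) (fock_kernel p) = (\<lambda>z. \<psi> p * fock_kernel p z)"
      using fixp by (intro fock_cohyponormal_wcomp_fixpoint) auto
    \<comment> \<open>The eigenvector equation is solved for \<psi> by dividing by an exponential,
      which never vanishes; putting z = 0 then identifies the constant.\<close>
    have \<psi>: "\<psi> z = \<psi> p * exp (- (cnj p * b)) * fock_kernel (p * (1 - cnj a)) z" for z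
    proof -
      have "\<psi> z * exp (cnj p * (a * z + b)) = \<psi> p * exp (cnj p * z)"
        using fun_cong[OF e, of z] by (simp add: wcomp_def fock_kernel_def)
      then have "\<psi> z = \<psi> p * (exp (cnj p * z) / exp (cnj p * (a * z + b)))"
        by (simp add: field_simps)
      also have "exp (cnj p * z) / exp (cnj p * (a * z + b)) = exp (- (cnj p * b)) * fock_kernel (p * (1 - cnj a)) z"
        unfolding K exp_diff[symmetric] exp_add[symmetric] by (simp add: algebra_simps)
      finally show ?thesis by simp
    qed
    have \<psi>0: "\<psi> 0 = \<psi> p * exp (- (cnj p * b))"
      using \<psi>[of 0] by (simp add: fock_kernel_def)
    have "\<psi> = (\<lambda>z. \<psi> 0 * fock_kernel (p * (1 - cnj a)) z)"
      unfolding \<psi>0 by (intro ext) (rule \<psi>)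
    then show "if a \<noteq> 1 then \<psi> = (\<lambda>z. \<psi> 0 * fock_kernel (b * (cnj a - 1) / (a - 1)) z)
          else \<psi> = (\<lambda>z. \<psi> 0 * fock_kernel (- b) z)"
      using False by (simp only: w if_True not_False_eq_True)
  next
    assume "if a \<noteq> 1 then \<psi> = (\<lambda>z. \<psi> 0 * fock_kernel (b * (cnj a - 1) / (a - 1)) z)
          else \<psi> = (\<lambda>z. \<psi> 0 * fock_kernel (- b) z)"
    then have \<psi>: "\<psi> = (\<lambda>z. \<psi> 0 * fock_kernel (p * (1 - cnj a)) z)"
      using False by (simp only: w if_True not_False_eq_True)
    \<comment> \<open>Conjugating the dilation by shifts gives the map a(z - p) + p, which is az +
      b. The kernel factors have exponent (1 - a) z cnj p + a |p|^2, and the scalar exp(-a |p|^2)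
      removes the constant term.\<close>
    have "wcomp \<psi> (\<lambda>z. a * z + b)
        = (\<lambda>f z. (\<psi> 0 * exp (- (a * (p * cnj p)))) * fock_shift p (fock_dilate a (fock_shift (- p) f)) z)"
    proof (intro ext)
      fix f z
      have "fock_kernel (p * (1 - cnj a)) z
          = exp (- (a * (p * cnj p))) * (fock_kernel p z * fock_kernel (- p) (a * (z - p)))"
        unfolding K fock_kernel_def exp_add[symmetric] by (simp add: algebra_simps)
      moreover have "a * (z - p) + p = a * z + b" by (simp add: b algebra_simps)
      ultimately show "wcomp \<psi> (\<lambda>z. a * z + b) f z
          = (\<psi> 0 * exp (- (a * (p * cnj p)))) * fock_shift p (fock_dilate a (fock_shift (- p) f)) z"
        by (subst \<psi>) (simp add: wcomp_def fock_shift_def fock_dilate_def)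
    qed
    from fock_conjugated_dilation_normal[OF assms(2) this]
    show "fock_bounded (wcomp \<psi> (\<lambda>z. a * z + b)) \<and> fock_cohyponormal (wcomp \<psi> (\<lambda>z. a * z + b))"
      by simp
  qed
qed

end
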